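(* Let $\gamma>1$ and $K\in\mathbb{R}$, and consider the two-sided sonic configuration $(\Omega^\pm,\varphi^\pm,\Gamma_{\rm sonic})$ described in the context. Let $Q\in\Gamma_{\rm sonic}$ be a sonic point with $U(Q)\neq0$, and suppose that, in a suitable local coordinate system $(\xi,\eta)$, the pseudo-streamline through $Q$ is the graph $\eta=F(\xi)$ with $F\in C^2((b_1,b_2))$, $b_1<b_2$. Write $Q=(\xi_Q,F(\xi_Q))$ and $F''(Q)=F''(\xi_Q)$. Then: (i) If $\partial^\perp c(Q)=0$, then $F''(Q)=0$. (ii) If $\partial^\perp c(Q)\neq0$ and $F$ can be defined (or extended) on the entire real line so that $\Omega^-\subset\{\eta>F(\xi)\}$, then $F''(Q)>0$.
   Context: Equation. Fix $\gamma>1$ and $K\in\mathbb{R}$. In coordinates $(\xi,\eta)\in\mathbb{R}^2$, with $D=(\partial_\xi,\partial_\eta)$, self-similar potential flow is $\mathrm{div}(\rho D\varphi)+2\rho=0$ with $\rho=(K-\varphi-\frac12|D\varphi|^2)^{1/(\gamma-1)}$. The sonic speed $c\ge 0$ is given by $c^2=(\gamma-1)(K-\varphi-\frac12|D\varphi|^2)$. The pseudo-velocity is $(U,V)=D\varphi$ and the velocity is $(u,v)=(U,V)+(\xi,\eta)$. Equivalently, $(c^2-U^2)u_\xi-UV(u_\eta+v_\xi)+(c^2-V^2)v_\eta=0$, $u_\eta=v_\xi$, and $\frac{c^2}{\gamma-1}+\frac{U^2+V^2}{2}+\varphi=K$. The solution is (pseudo-)supersonic where $|D\varphi|>c$, (pseudo-)subsonic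 where $|D\varphi|<c$, and a point is (pseudo-)sonic if $|D\varphi|=c$. Configuration. $\Omega^-$ and $\Omega^+$ are the supersonic and subsonic regions, lying on the two sides of the curve formed by all sonic points; $\Gamma_{\rm sonic}$ denotes the relative interior of that curve. $\varphi^-\in C^2(\overline{\Omega^-})$ is a supersonic solution in $\Omega^-$, $\varphi^+\in C^2(\Omega^+\cup\Gamma_{\rm sonic})$ is a subsonic solution in $\Omega^+$, and $\varphi^+=\varphi^-$, $D\varphi^+=D\varphi^-$ on $\Gamma_{\rm sonic}$. Write $\varphi=\varphi^\pm$ on the respective sides. For each $Q\in\Gamma_{\rm sonic}$, in suitable (rotated) coordinates $(\xi,\eta)$ (the equations are invariant under rotation) there is $r>0$ such that $\Gamma_{\rm sonic}\cap B_r(Q)=\{\eta=f(\xi)\}\cap B_r(Q)$ with $f\in C^{1,1}((l_1,l_2))$, $l_1<l_2$. Notation. $\partial^\perp=V\partial_\xi-U\partial_\eta$; derivatives of $c$ at points of $\Gamma_{\rm sonic}$ are one-sided. A pseudo-streamline is an integral curve of $(U,V)$, i.e. a curve having $(U,V)$ as tangential vector, so that $F'(\xi)=\frac{V}{U}(\xi,F(\xi))$ near $Q$. *)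

theory Defs
  imports "HOL-Analysis.Analysis"
begin

section \<open>Derivatives in the plane\<close>

definition d_xi :: "(real \<times> real \<Rightarrow> real) \<Rightarrow> real \<times> real \<Rightarrow> real" where
  "d_xi f p = frechet_derivative f (at p) (1, 0)"

definition d_eta :: "(real \<times> real \<Rightarrow> real) \<Rightarrow> real \<times> real \<Rightarrow> real" where
  "d_eta f p = frechet_derivative f (at p) (0, 1)"

definition grad :: "(real \<times> real \<Rightarrow> real) \<Rightarrow> real \<times> real \<Rightarrow> real \<times> real" where
  "grad f p = (d_xi f p, d_eta f p)"

definition C1_fun_on :: "(real \<times> real) set \<Rightarrow> (real \<times> real \<Rightarrow> real) \<Rightarrow> bool" where
  "C1_fun_on A f \<longleftrightarrow>
     (\<forall>p\<in>A. f differentiable (at p)) \<and> continuous_on A (d_xi f) \<and> continuous_on A (d_eta f)"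

definition C2_fun_on :: "(real \<times> real) set \<Rightarrow> (real \<times> real \<Rightarrow> real) \<Rightarrow> bool" where
  "C2_fun_on A f \<longleftrightarrow> C1_fun_on A f \<and> C1_fun_on A (d_xi f) \<and> C1_fun_on A (d_eta f)"

definition extends_continuously ::
    "(real \<times> real) set \<Rightarrow> (real \<times> real) set \<Rightarrow> (real \<times> real \<Rightarrow> real) \<Rightarrow> bool" where
  "extends_continuously A S g \<longleftrightarrow> (\<exists>h. continuous_on S h \<and> (\<forall>p\<in>A. h p = g p))"

text \<open>The space \<open>C\<^sup>2(S)\<close> for an open set \<open>A\<close> and \<open>A \<subseteq> S \<subseteq> closure A\<close>: all derivatives of
  order at most two exist in \<open>A\<close> and extend continuously to \<open>S\<close>.\<close>

definition C2_up_to ::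
    "(real \<times> real) set \<Rightarrow> (real \<times> real) set \<Rightarrow> (real \<times> real \<Rightarrow> real) \<Rightarrow> bool" where
  "C2_up_to A S f \<longleftrightarrow>
     A \<subseteq> S \<and> S \<subseteq> closure A \<and> C2_fun_on A f \<and> continuous_on S f \<and>
     (\<forall>g \<in> {d_xi f, d_eta f, d_xi (d_xi f), d_eta (d_xi f), d_xi (d_eta f), d_eta (d_eta f)}.
        extends_continuously A S g)"

text \<open>The value at \<open>p\<close> of the continuous extension of \<open>g\<close> from \<open>A\<close>. On the boundary of \<open>A\<close> this
  gives one-sided values; at points of the open set \<open>A\<close> it is the value of \<open>g\<close> if \<open>g\<close> is
  continuous there.\<close>

definition trace_from :: "(real \<times> real) set \<Rightarrow> (real \<times> real \<Rightarrow> 'b::t2_space) \<Rightarrow> real \<times> real \<Rightarrow> 'b" where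
  "trace_from A g p = Lim (at p within A) g"

section \<open>Self-similar potential flow\<close>

text \<open>Here \<open>z\<close> stands for the value of the potential and \<open>w\<close> for its gradient \<open>(U, V)\<close>.\<close>

definition bernoulli :: "real \<Rightarrow> real \<Rightarrow> real \<times> real \<Rightarrow> real" where
  "bernoulli K z w = K - z - (norm w)\<^sup>2 / 2"

definition density :: "real \<Rightarrow> real \<Rightarrow> real \<Rightarrow> real \<times> real \<Rightarrow> real" where
  "density \<gamma> K z w = bernoulli K z w powr (1 / (\<gamma> - 1))"

definition sonic_speed :: "real \<Rightarrow> real \<Rightarrow> real \<Rightarrow> real \<times> real \<Rightarrow> real" where
  "sonic_speed \<gamma> K z w = sqrt ((\<gamma> - 1) * bernoulli K z w)"

text \<open>Classical solution of \<open>div (\<rho> D\<phi>) + 2 \<rho> = 0\<close>. Nonnegativity of the Bernoulli quantity makes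
  the sonic speed well defined; where it is positive, the differentiability of \<open>\<rho> D\<phi>\<close> is automatic
  for a twice continuously differentiable potential.\<close>

definition potential_flow_on ::
    "real \<Rightarrow> real \<Rightarrow> (real \<times> real) set \<Rightarrow> (real \<times> real \<Rightarrow> real) \<Rightarrow> bool" where
  "potential_flow_on \<gamma> K A \<phi> \<longleftrightarrow>
     (let \<rho> = (\<lambda>p. density \<gamma> K (\<phi> p) (grad \<phi> p));
          mU = (\<lambda>p. \<rho> p * d_xi \<phi> p);
          mV = (\<lambda>p. \<rho> p * d_eta \<phi> p)
      in \<forall>p\<in>A. 0 \<le> bernoulli K (\<phi> p) (grad \<phi> p) \<and>
               mU differentiable (at p) \<and> mV differentiable (at p) \<and>
               d_xi mU p + d_eta mV p + 2 * \<rho> p = 0)"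

definition supersonic_on ::
    "real \<Rightarrow> real \<Rightarrow> (real \<times> real) set \<Rightarrow> (real \<times> real \<Rightarrow> real) \<Rightarrow> bool" where
  "supersonic_on \<gamma> K A \<phi> \<longleftrightarrow>
     (\<forall>p\<in>A. norm (grad \<phi> p) > sonic_speed \<gamma> K (\<phi> p) (grad \<phi> p))"

definition subsonic_on ::
    "real \<Rightarrow> real \<Rightarrow> (real \<times> real) set \<Rightarrow> (real \<times> real \<Rightarrow> real) \<Rightarrow> bool" where
  "subsonic_on \<gamma> K A \<phi> \<longleftrightarrow>
     (\<forall>p\<in>A. norm (grad \<phi> p) < sonic_speed \<gamma> K (\<phi> p) (grad \<phi> p))"

text \<open>The sonic points of a potential that is \<open>C\<^sup>2\<close> up to the boundary of \<open>A\<close>.\<close>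

definition sonic_points ::
    "real \<Rightarrow> real \<Rightarrow> (real \<times> real) set \<Rightarrow> (real \<times> real \<Rightarrow> real) \<Rightarrow> (real \<times> real) set" where
  "sonic_points \<gamma> K A \<phi> =
     {p \<in> closure A. norm (trace_from A (grad \<phi>) p) =
                     sonic_speed \<gamma> K (\<phi> p) (trace_from A (grad \<phi>) p)}"

text \<open>The one-sided value at \<open>p\<close>, taken from \<open>A\<close>, of \<open>V c\<^sub>\<xi> - U c\<^sub>\<eta>\<close>.\<close>

definition perp_deriv_c ::
    "real \<Rightarrow> real \<Rightarrow> (real \<times> real) set \<Rightarrow> (real \<times> real \<Rightarrow> real) \<Rightarrow> real \<times> real \<Rightarrow> real" where
  "perp_deriv_c \<gamma> K A \<phi> p =
     (let c = (\<lambda>q. sonic_speed \<gamma> K (\<phi> q) (grad \<phi> q));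
          U = trace_from A (d_xi \<phi>) p;
          V = trace_from A (d_eta \<phi>) p
      in V * trace_from A (d_xi c) p - U * trace_from A (d_eta c) p)"

section \<open>Curves in the plane\<close>

text \<open>Curves are connected topological one-manifolds, possibly with boundary; this includes arcs,
  closed curves and unbounded curves. The relative interior omits the end points.\<close>

definition is_curve :: "(real \<times> real) set \<Rightarrow> bool" where
  "is_curve C \<longleftrightarrow> connected C \<and>
     (\<forall>p\<in>C. \<exists>W. open W \<and> p \<in> W \<and>
        ((C \<inter> W) homeomorphic (UNIV :: real set) \<or> (C \<inter> W) homeomorphic ({0..} :: real set)))"

definition curve_interior :: "(real \<times> real) set \<Rightarrow> (real \<times> real) set" where
  "curve_interior C =
     {p \<in> C. \<exists>W. open W \<and> p \<in> W \<and> (C \<inter> W) homeomorphic (UNIV :: real set)}"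

definition C11_on :: "real set \<Rightarrow> (real \<Rightarrow> real) \<Rightarrow> bool" where
  "C11_on I f \<longleftrightarrow> f differentiable_on I \<and> (\<exists>L. L-lipschitz_on I (deriv f))"

definition C2_real_on :: "real set \<Rightarrow> (real \<Rightarrow> real) \<Rightarrow> bool" where
  "C2_real_on I f \<longleftrightarrow>
     f differentiable_on I \<and> deriv f differentiable_on I \<and> continuous_on I (deriv (deriv f))"

section \<open>The two-sided sonic configuration\<close>

record sonic_flow =
  Omega_minus :: "(real \<times> real) set"
  Omega_plus :: "(real \<times> real) set"
  phi_minus :: "real \<times> real \<Rightarrow> real"
  phi_plus :: "real \<times> real \<Rightarrow> real"
  Gamma_sonic :: "(real \<times> real) set"

definition rot :: "real \<Rightarrow> real \<times> real \<Rightarrow> real \<times> real" where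
  "rot \<theta> p = (cos \<theta> * fst p - sin \<theta> * snd p, sin \<theta> * fst p + cos \<theta> * snd p)"

text \<open>The same flow in rotated coordinates: the point with new coordinates \<open>p\<close> has old
  coordinates \<open>rot \<theta> p\<close>.\<close>

definition rotate_coords :: "real \<Rightarrow> sonic_flow \<Rightarrow> sonic_flow" where
  "rotate_coords \<theta> S =
     \<lparr> Omega_minus = rot \<theta> -` Omega_minus S,
       Omega_plus = rot \<theta> -` Omega_plus S,
       phi_minus = phi_minus S \<circ> rot \<theta>,
       phi_plus = phi_plus S \<circ> rot \<theta>,
       Gamma_sonic = rot \<theta> -` Gamma_sonic S \<rparr>"

text \<open>Near \<open>Q\<close> the sonic curve is the graph of a \<open>C\<^sup>1\<^sup>,\<^sup>1\<close> function with the two regions on its two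
  sides. This is used after a rotation of the coordinates, and a rotation by \<open>\<pi>\<close> exchanges the sides
  above and below, so placing \<open>\<Omega>\<^sup>-\<close> above is no restriction.\<close>

definition sonic_graph_near :: "sonic_flow \<Rightarrow> real \<times> real \<Rightarrow> bool" where
  "sonic_graph_near S Q \<longleftrightarrow>
     (\<exists>r l1 l2 f. 0 < r \<and> l1 < l2 \<and> C11_on {l1<..<l2} f \<and>
        Gamma_sonic S \<inter> ball Q r = {(\<xi>, \<eta>). \<xi> \<in> {l1<..<l2} \<and> \<eta> = f \<xi>} \<inter> ball Q r \<and>
        {(\<xi>, \<eta>). \<xi> \<in> {l1<..<l2} \<and> \<eta> > f \<xi>} \<inter> ball Q r \<subseteq> Omega_minus S \<and>
        {(\<xi>, \<eta>). \<xi> \<in> {l1<..<l2} \<and> \<eta> < f \<xi>} \<inter> ball Q r \<subseteq> Omega_plus S)"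

definition sonic_configuration :: "real \<Rightarrow> real \<Rightarrow> sonic_flow \<Rightarrow> bool" where
  "sonic_configuration \<gamma> K S \<longleftrightarrow>
     open (Omega_minus S) \<and> open (Omega_plus S) \<and> Omega_minus S \<inter> Omega_plus S = {} \<and>
     C2_up_to (Omega_minus S) (closure (Omega_minus S)) (phi_minus S) \<and>
     C2_up_to (Omega_plus S) (Omega_plus S \<union> Gamma_sonic S) (phi_plus S) \<and>
     potential_flow_on \<gamma> K (Omega_minus S) (phi_minus S) \<and>
     supersonic_on \<gamma> K (Omega_minus S) (phi_minus S) \<and>
     potential_flow_on \<gamma> K (Omega_plus S) (phi_plus S) \<and>
     subsonic_on \<gamma> K (Omega_plus S) (phi_plus S) \<and>
     is_curve (sonic_points \<gamma> K (Omega_minus S) (phi_minus S)) \<and>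
     Gamma_sonic S = curve_interior (sonic_points \<gamma> K (Omega_minus S) (phi_minus S)) \<and>
     (\<forall>p \<in> Gamma_sonic S.
        phi_plus S p = phi_minus S p \<and>
        trace_from (Omega_plus S) (grad (phi_plus S)) p =
          trace_from (Omega_minus S) (grad (phi_minus S)) p) \<and>
     (\<forall>Q \<in> Gamma_sonic S. \<exists>\<theta>. sonic_graph_near (rotate_coords \<theta> S) (rot (- \<theta>) Q))"

text \<open>The pseudo-velocity \<open>(U, V)\<close> of the composite flow on \<open>\<Omega>\<^sup>- \<union> \<Gamma> \<union> \<Omega>\<^sup>+\<close>; on the sonic curve
  the values from the two sides agree.\<close>

definition pseudo_velocity :: "sonic_flow \<Rightarrow> real \<times> real \<Rightarrow> real \<times> real" where
  "pseudo_velocity S p =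
     (if p \<in> Omega_plus S then grad (phi_plus S) p
      else trace_from (Omega_minus S) (grad (phi_minus S)) p)"

text \<open>The graph of \<open>F\<close> over \<open>I\<close> lies in the flow region and \<open>(U, V)\<close> is a multiple of the
  tangent vector \<open>(1, F')\<close>; in particular \<open>F' = V / U\<close> wherever \<open>U \<noteq> 0\<close>.\<close>

definition streamline_graph :: "sonic_flow \<Rightarrow> real set \<Rightarrow> (real \<Rightarrow> real) \<Rightarrow> bool" where
  "streamline_graph S I F \<longleftrightarrow>
     (\<forall>\<xi>\<in>I. (\<xi>, F \<xi>) \<in> Omega_minus S \<union> Gamma_sonic S \<union> Omega_plus S \<and>
        (\<exists>t. pseudo_velocity S (\<xi>, F \<xi>) = t *\<^sub>R (1, deriv F \<xi>)))"

end

theory Submission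
  imports Defs
begin

text \<open>Write \<open>W = (U, V)\<close> for the velocity at \<open>Q\<close> and \<open>W\<^sup>\<bottom> = (V, - U)\<close>. At a sonic point the flow equation
  reduces to \<open>D\<^sup>2\<phi>[W\<^sup>\<bottom>, W\<^sup>\<bottom>] = - |W|\<^sup>2\<close> on both sides. Since \<open>D\<phi>\<close> is continuous across the sonic curve,
  the two Hessians differ by a multiple \<open>a n n\<^sup>T\<close>, \<open>n\<close> the normal, and the equation forces
  \<open>a (n \<cdot> W\<^sup>\<bottom>)\<^sup>2 = 0\<close>. So \<open>D\<^sup>2\<phi>[W\<^sup>\<bottom>, \<cdot>]\<close> is the same from both sides, and
  \<open>\<partial>\<^sup>\<bottom>c = - (\<gamma> - 1) / (2 c) D\<^sup>2\<phi>[W, W\<^sup>\<bottom>]\<close> and \<open>F'' = - D\<^sup>2\<phi>[W, W\<^sup>\<bottom>] / U\<^sup>3\<close> vanish together, even if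
  the streamline crosses the sonic curve infinitely often.
  If \<open>\<Omega>\<^sup>-\<close> lies above the streamline, the sonic curve is tangent to it at \<open>Q\<close>. The derivative of
  \<open>|D\<phi>|\<^sup>2 - c\<^sup>2\<close> then vanishes along the streamline and is nonnegative in the direction
  \<open>(- F', 1)\<close> pointing into \<open>\<Omega>\<^sup>-\<close>, where it equals \<open>(\<gamma> + 1) U\<^sup>2 F''\<close>.\<close>

section \<open>Symmetry of second derivatives\<close>

text \<open>Two applications of the mean value theorem: in the first variable to the difference of
  the values of \<open>f\<close> on two opposite edges of the square, then in the second variable to
  \<open>fx\<close>.\<close>

lemma second_difference_mean_value:
  fixes f fx fy fxx fxy :: "real \<times> real \<Rightarrow> real"
  assumes h: "0 < h"
    and f: "\<And>x y. \<lbrakk>a \<le> x; x \<le> a + h; b \<le> y; y \<le> b + h\<rbrakk> \<Longrightarrow>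
      (f has_derivative (\<lambda>v. fx (x, y) * fst v + fy (x, y) * snd v)) (at (x, y))"
    and fx: "\<And>x y. \<lbrakk>a \<le> x; x \<le> a + h; b \<le> y; y \<le> b + h\<rbrakk> \<Longrightarrow>
      (fx has_derivative (\<lambda>v. fxx (x, y) * fst v + fxy (x, y) * snd v)) (at (x, y))"
  obtains x y where "a < x" "x < a + h" "b < y" "y < b + h"
    "f (a + h, b + h) - f (a + h, b) - f (a, b + h) + f (a, b) = h\<^sup>2 * fxy (x, y)"
proof -
  have path: "((\<lambda>t. (t, c)) has_derivative (\<lambda>u. (u, 0))) (at t)"
    "((\<lambda>t. (c, t)) has_derivative (\<lambda>u. (0, u))) (at t)" for c t :: real
    by (auto intro!: derivative_eq_intros)
  have fx_line: "((\<lambda>t. f (t, y)) has_real_derivative fx (x, y)) (at x)"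
    if "a \<le> x" "x \<le> a + h" "b \<le> y" "y \<le> b + h" for x y
    using has_derivative_compose[OF path(1) f[OF that]]
    by (auto simp: has_field_derivative_def mult.commute[of _ "fx (x, y)"])
  have fxy_line: "((\<lambda>t. fx (x, t)) has_real_derivative fxy (x, y)) (at y)"
    if "a \<le> x" "x \<le> a + h" "b \<le> y" "y \<le> b + h" for x y
    using has_derivative_compose[OF path(2) fx[OF that]]
    by (auto simp: has_field_derivative_def mult.commute[of _ "fxy (x, y)"])
  obtain x where x: "a < x" "x < a + h"
    "(f (a + h, b + h) - f (a + h, b)) - (f (a, b + h) - f (a, b))
      = (a + h - a) * (fx (x, b + h) - fx (x, b))"
  proof -
    have "\<exists>z>a. z < a + h \<and> (f (a + h, b + h) - f (a + h, b)) - (f (a, b + h) - f (a, b))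
      = (a + h - a) * (fx (z, b + h) - fx (z, b))"
      using h by (intro MVT2) (auto intro!: derivative_intros fx_line)
    then show thesis using that by blast
  qed
  obtain y where y: "b < y" "y < b + h" "fx (x, b + h) - fx (x, b) = (b + h - b) * fxy (x, y)"
  proof -
    have "\<exists>z>b. z < b + h \<and> fx (x, b + h) - fx (x, b) = (b + h - b) * fxy (x, z)"
      using h x by (intro MVT2) (auto intro!: fxy_line)
    then show thesis using that by blast
  qed
  show thesis
    using x y by (intro that[of x y]) (auto simp: power2_eq_square)
qed

text \<open>The second difference over a square does not change when the two variables are
  exchanged. Evaluated in both orders, it gives values of \<open>fxy\<close> and \<open>fyx\<close>
  that agree at points arbitrarily near \<open>p\<close>; continuity carries the equality to
  \<open>p\<close>.\<close>

lemma mixed_partials_eq: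
  fixes f fx fy fxx fxy fyx fyy :: "real \<times> real \<Rightarrow> real"
  assumes A: "open A" "p \<in> A"
    and f: "\<And>q. q \<in> A \<Longrightarrow> (f has_derivative (\<lambda>v. fx q * fst v + fy q * snd v)) (at q)"
    and fx: "\<And>q. q \<in> A \<Longrightarrow> (fx has_derivative (\<lambda>v. fxx q * fst v + fxy q * snd v)) (at q)"
    and fy: "\<And>q. q \<in> A \<Longrightarrow> (fy has_derivative (\<lambda>v. fyx q * fst v + fyy q * snd v)) (at q)"
    and cont: "continuous_on A fxy" "continuous_on A fyx"
  shows "fxy p = fyx p"
proof -
  obtain r where r: "r > 0" "ball p r \<subseteq> A"
    using A open_contains_ball by blast
  obtain a b where p: "p = (a, b)" by (cases p)
  have swap: "((\<lambda>q. F (snd q, fst q)) has_derivative (\<lambda>v. D (snd v, fst v))) (at (y, x))"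
    if "(F has_derivative D) (at (x, y))" for F :: "real \<times> real \<Rightarrow> real" and D x y
  proof -
    have "((\<lambda>q. (snd q, fst q)) has_derivative (\<lambda>v. (snd v, fst v))) (at (y, x))"
      by (auto intro!: derivative_eq_intros)
    from has_derivative_compose[OF this, of F D] that show ?thesis by simp
  qed
  have close: "\<exists>q q'. dist q p < e \<and> dist q' p < e \<and> q \<in> A \<and> q' \<in> A \<and> fxy q = fyx q'" if e: "e > 0" for e
  proof -
    \<comment> \<open>Points of the square with corner \<open>p\<close> and side \<open>h\<close>
      have distance at most \<open>2 * h\<close> from \<open>p\<close>, so the factor 4 leaves room
      in both balls.\<close>
    define h where "h = min e r / 4"
    have h: "0 < h" "2 * h < e" "2 * h < r" using e r by (auto simp: h_def)
    have dist: "dist (x, y) p < e \<and> dist (x, y) p < r"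
      if "a \<le> x" "x \<le> a + h" "b \<le> y" "y \<le> b + h" for x y
    proof -
      have "dist (x, y) p \<le> \<bar>x - a\<bar> + \<bar>y - b\<bar>"
        using sqrt_sum_squares_le_sum_abs by (simp add: p dist_Pair_Pair dist_real_def)
      then show ?thesis using that h by auto
    qed
    then have inA: "(x, y) \<in> A" if "a \<le> x" "x \<le> a + h" "b \<le> y" "y \<le> b + h" for x y
      using that r by (force simp: dist_commute)
    obtain x y where xy: "a < x" "x < a + h" "b < y" "y < b + h"
      "f (a + h, b + h) - f (a + h, b) - f (a, b + h) + f (a, b) = h\<^sup>2 * fxy (x, y)"
      by (rule second_difference_mean_value[OF h(1), of a b f fx fy fxx fxy]) (auto intro: f fx inA)
    obtain y' x' where xy': "b < y'" "y' < b + h" "a < x'" "x' < a + h"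
      "f (a + h, b + h) - f (a, b + h) - f (a + h, b) + f (a, b) = h\<^sup>2 * fyx (x', y')"
    proof (rule second_difference_mean_value[OF h(1), of b a "\<lambda>q. f (snd q, fst q)"
          "\<lambda>q. fy (snd q, fst q)" "\<lambda>q. fx (snd q, fst q)" "\<lambda>q. fyy (snd q, fst q)"
          "\<lambda>q. fyx (snd q, fst q)"])
      fix y x assume *: "b \<le> y" "y \<le> b + h" "a \<le> x" "x \<le> a + h"
      from swap[OF f[OF inA[OF *(3,4,1,2)]]]
      show "((\<lambda>q. f (snd q, fst q)) has_derivative
        (\<lambda>v. fy (snd (y, x), fst (y, x)) * fst v + fx (snd (y, x), fst (y, x)) * snd v)) (at (y, x))"
        by (simp add: add.commute)
      from swap[OF fy[OF inA[OF *(3,4,1,2)]]]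
      show "((\<lambda>q. fy (snd q, fst q)) has_derivative
        (\<lambda>v. fyy (snd (y, x), fst (y, x)) * fst v + fyx (snd (y, x), fst (y, x)) * snd v)) (at (y, x))"
        by (simp add: add.commute)
    qed auto
    have "h\<^sup>2 * fxy (x, y) = h\<^sup>2 * fyx (x', y')" using xy xy' by linarith
    then have "fxy (x, y) = fyx (x', y')" using h by simp
    then show ?thesis
      using dist[of x y] dist[of x' y'] inA[of x y] inA[of x' y'] xy xy'
      by (intro exI[of _ "(x, y)"] exI[of _ "(x', y')"]) auto
  qed
  show ?thesis
  proof (rule ccontr)
    assume "fxy p \<noteq> fyx p"
    define \<epsilon> where "\<epsilon> = \<bar>fxy p - fyx p\<bar> / 2"
    have \<epsilon>: "\<epsilon> > 0" using \<open>fxy p \<noteq> fyx p\<close> by (simp add: \<epsilon>_def)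
    obtain d1 where d1: "d1 > 0" "\<And>q. q \<in> A \<Longrightarrow> dist q p < d1 \<Longrightarrow> dist (fxy q) (fxy p) < \<epsilon>"
      using cont(1) A \<epsilon> unfolding continuous_on_iff by meson
    obtain d2 where d2: "d2 > 0" "\<And>q. q \<in> A \<Longrightarrow> dist q p < d2 \<Longrightarrow> dist (fyx q) (fyx p) < \<epsilon>"
      using cont(2) A \<epsilon> unfolding continuous_on_iff by meson
    obtain q q' where q: "dist q p < min d1 d2" "dist q' p < min d1 d2" "q \<in> A" "q' \<in> A"
      "fxy q = fyx q'"
      using close[of "min d1 d2"] d1 d2 by auto
    have "dist (fxy q) (fxy p) < \<epsilon>" "dist (fyx q') (fyx p) < \<epsilon>"
      using d1(2)[of q] d2(2)[of q'] q by simp_all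
    then show False using q(5) by (auto simp: dist_real_def \<epsilon>_def abs_if split: if_splits)
  qed
qed

section \<open>Potentials that are twice differentiable up to the boundary\<close>

text \<open>An open set in a space without isolated points accumulates at every point of its
  closure. This makes the limit behind \<open>trace_from\<close> unique.\<close>

lemma not_trivial_limit_closure_open:
  fixes A :: "'a::perfect_space set"
  assumes "open A" "p \<in> closure A"
  shows "at p within A \<noteq> bot"
  using assms by (metis closure_def Un_iff mem_Collect_eq at_within_open at_neq_bot trivial_limit_within)

lemma trace_from_eqI:
  assumes "(g \<longlongrightarrow> l) (at p within A)" "open A" "p \<in> closure A"
  shows "trace_from A g p = l"
  unfolding trace_from_def
  using assms tendsto_Lim not_trivial_limit_closure_open by blast

text \<open>The limit is taken inside \<open>A\<close>, where \<open>g\<close> and \<open>h\<close>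
  agree, so a trace can be read off from any continuous extension.\<close>

lemma trace_from_continuous_on:
  assumes "continuous_on B h" "\<And>q. q \<in> A \<Longrightarrow> h q = g q"
    and "open A" "A \<subseteq> B" "B \<subseteq> closure A" "p \<in> B"
  shows "trace_from A g p = h p"
proof (rule trace_from_eqI)
  have "(h \<longlongrightarrow> h p) (at p within A)"
    using assms(1,4,6) unfolding continuous_on_def by (blast intro: tendsto_within_subset)
  then show "(g \<longlongrightarrow> h p) (at p within A)"
    by (rule Lim_transform_within[OF _ zero_less_one]) (use assms(2) in auto)
qed (use assms in auto)

text \<open>The continuous extensions of gradient and Hessian to \<open>B\<close> are made explicit, so that boundary
  values need no limits and rotations act on them directly.\<close>

locale c2_side =
  fixes A B :: "(real \<times> real) set" and \<phi> :: "real \<times> real \<Rightarrow> real"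
    and g :: "real \<times> real \<Rightarrow> real \<times> real" and H :: "real \<times> real \<Rightarrow> real \<times> real \<Rightarrow> real \<times> real"
  assumes open_A: "open A" and A_sub_B: "A \<subseteq> B" and B_sub_closure: "B \<subseteq> closure A"
    and cont_\<phi>: "continuous_on B \<phi>" and cont_g: "continuous_on B g"
    and cont_H: "continuous_on B (\<lambda>p. H p v)"
    and linear_H: "p \<in> B \<Longrightarrow> linear (H p)"
    and symmetric_H: "p \<in> B \<Longrightarrow> v \<bullet> H p w = w \<bullet> H p v"
    and deriv_\<phi>: "p \<in> A \<Longrightarrow> (\<phi> has_derivative (\<lambda>v. g p \<bullet> v)) (at p)"
    and deriv_g: "p \<in> A \<Longrightarrow> (g has_derivative H p) (at p)"

lemma frechet_partials:
  assumes "f differentiable (at p)"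
  shows "(f has_derivative (\<lambda>v. d_xi f p * fst v + d_eta f p * snd v)) (at p)"
proof -
  have D: "(f has_derivative frechet_derivative f (at p)) (at p)"
    using assms frechet_derivative_works by blast
  then interpret linear "frechet_derivative f (at p)"
    by (rule has_derivative_linear)
  have "frechet_derivative f (at p) v = d_xi f p * fst v + d_eta f p * snd v" for v
  proof -
    have "v = fst v *\<^sub>R (1, 0) + snd v *\<^sub>R (0, 1)" by (cases v) auto
    then have "frechet_derivative f (at p) v = frechet_derivative f (at p) (fst v *\<^sub>R (1, 0) + snd v *\<^sub>R (0, 1))"
      by simp
    then show ?thesis by (simp only: add scale d_xi_def d_eta_def) simp
  qed
  then have "frechet_derivative f (at p) = (\<lambda>v. d_xi f p * fst v + d_eta f p * snd v)"
    by (rule ext)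
  with D show ?thesis by simp
qed

lemma partials_of_has_derivative:
  assumes "(f has_derivative D) (at p)"
  shows "d_xi f p = D (1, 0)" "d_eta f p = D (0, 1)"
  using frechet_derivative_at[OF assms] by (simp_all add: d_xi_def d_eta_def)

lemma C2_up_to_imp_c2_side:
  assumes C2: "C2_up_to A B \<phi>" and A: "open A"
  obtains g H where "c2_side A B \<phi> g H"
proof -
  have sub: "A \<subseteq> B" "B \<subseteq> closure A" and cont: "continuous_on B \<phi>"
    and C1: "C1_fun_on A \<phi>" "C1_fun_on A (d_xi \<phi>)" "C1_fun_on A (d_eta \<phi>)"
    using C2 by (auto simp: C2_up_to_def C2_fun_on_def)
  have ext: "extends_continuously A B k"
    if "k \<in> {d_xi \<phi>, d_eta \<phi>, d_xi (d_xi \<phi>), d_eta (d_xi \<phi>), d_xi (d_eta \<phi>), d_eta (d_eta \<phi>)}" for k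
    using C2 that unfolding C2_up_to_def by blast
  obtain U where U: "continuous_on B U" "\<And>p. p \<in> A \<Longrightarrow> U p = d_xi \<phi> p"
    using ext[of "d_xi \<phi>"] by (auto simp: extends_continuously_def)
  obtain V where V: "continuous_on B V" "\<And>p. p \<in> A \<Longrightarrow> V p = d_eta \<phi> p"
    using ext[of "d_eta \<phi>"] by (auto simp: extends_continuously_def)
  obtain a where a: "continuous_on B a" "\<And>p. p \<in> A \<Longrightarrow> a p = d_xi (d_xi \<phi>) p"
    using ext[of "d_xi (d_xi \<phi>)"] by (auto simp: extends_continuously_def)
  obtain b where b: "continuous_on B b" "\<And>p. p \<in> A \<Longrightarrow> b p = d_eta (d_xi \<phi>) p"
    using ext[of "d_eta (d_xi \<phi>)"] by (auto simp: extends_continuously_def)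
  obtain c where c: "continuous_on B c" "\<And>p. p \<in> A \<Longrightarrow> c p = d_eta (d_eta \<phi>) p"
    using ext[of "d_eta (d_eta \<phi>)"] by (auto simp: extends_continuously_def)
  have D\<phi>: "(\<phi> has_derivative (\<lambda>v. d_xi \<phi> p * fst v + d_eta \<phi> p * snd v)) (at p)"
    and DU: "(d_xi \<phi> has_derivative (\<lambda>v. d_xi (d_xi \<phi>) p * fst v + d_eta (d_xi \<phi>) p * snd v)) (at p)"
    and DV: "(d_eta \<phi> has_derivative (\<lambda>v. d_xi (d_eta \<phi>) p * fst v + d_eta (d_eta \<phi>) p * snd v)) (at p)"
    if "p \<in> A" for p
    using C1 that by (auto simp: C1_fun_on_def intro!: frechet_partials)
  have mixed: "d_eta (d_xi \<phi>) p = d_xi (d_eta \<phi>) p" if "p \<in> A" for p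
    by (rule mixed_partials_eq[OF A that D\<phi> DU DV]) (use C1 in \<open>auto simp: C1_fun_on_def\<close>)
  define g where "g = (\<lambda>p. (U p, V p))"
  \<comment> \<open>The extension \<open>b\<close> of one mixed derivative fills both off-diagonal
    entries: symmetry then holds on all of \<open>B\<close> by construction, and
    \<open>mixed\<close> makes \<open>H\<close> the derivative of \<open>g\<close> on
    \<open>A\<close>.\<close>
  define H where "H = (\<lambda>p v. (a p * fst v + b p * snd v, b p * fst v + c p * snd v))"
  have "c2_side A B \<phi> g H"
  proof (rule c2_side.intro)
    fix p assume p: "p \<in> A"
    show "(\<phi> has_derivative (\<lambda>v. g p \<bullet> v)) (at p)"
      using D\<phi>[OF p] p by (simp add: g_def U V inner_prod_def)
    have "((\<lambda>q. (d_xi \<phi> q, d_eta \<phi> q)) has_derivative H p) (at p)"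
      unfolding H_def using DU[OF p] DV[OF p] p by (auto simp: a b c mixed intro!: has_derivative_Pair)
    then show "(g has_derivative H p) (at p)"
      by (rule has_derivative_transform_within_open[OF _ A p]) (simp add: g_def U V)
  next
    show "continuous_on B g" unfolding g_def by (intro continuous_intros U V)
    show "continuous_on B (\<lambda>p. H p v)" for v unfolding H_def by (intro continuous_intros a b c)
    show "linear (H p)" for p by (rule linearI) (simp_all add: H_def algebra_simps)
    show "v \<bullet> H p w = w \<bullet> H p v" for p v w by (simp add: H_def inner_prod_def algebra_simps)
  qed (use A sub cont in auto)
  then show thesis by (rule that)
qed

context c2_side begin

lemma grad_eq: "p \<in> A \<Longrightarrow> grad \<phi> p = g p"
  using partials_of_has_derivative[OF deriv_\<phi>, of p]
  by (cases "g p") (simp add: grad_def)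

lemma d_xi_eq: "p \<in> A \<Longrightarrow> d_xi \<phi> p = fst (g p)" and d_eta_eq: "p \<in> A \<Longrightarrow> d_eta \<phi> p = snd (g p)"
  using grad_eq[of p] by (auto simp: grad_def dest: sym)

lemma trace_grad: "p \<in> B \<Longrightarrow> trace_from A (grad \<phi>) p = g p"
  by (rule trace_from_continuous_on[OF cont_g]) (use open_A A_sub_B B_sub_closure grad_eq in auto)

lemma trace_d_xi: "p \<in> B \<Longrightarrow> trace_from A (d_xi \<phi>) p = fst (g p)"
  by (rule trace_from_continuous_on[OF continuous_on_fst[OF cont_g]])
     (use open_A A_sub_B B_sub_closure d_xi_eq in auto)

lemma trace_d_eta: "p \<in> B \<Longrightarrow> trace_from A (d_eta \<phi>) p = snd (g p)"
  by (rule trace_from_continuous_on[OF continuous_on_snd[OF cont_g]])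
     (use open_A A_sub_B B_sub_closure d_eta_eq in auto)

lemma H_components:
  assumes "p \<in> B"
  shows "H p v = fst v *\<^sub>R H p (1, 0) + snd v *\<^sub>R H p (0, 1)"
proof -
  interpret linear "H p" using assms by (rule linear_H)
  have "v = fst v *\<^sub>R (1, 0) + snd v *\<^sub>R (0, 1)" by (cases v) auto
  then have "H p v = H p (fst v *\<^sub>R (1, 0) + snd v *\<^sub>R (0, 1))" by simp
  then show ?thesis by (simp only: add scale)
qed

end

section \<open>Rotations and the non-divergence form\<close>

lemma rot_components [simp]:
  "fst (rot \<theta> p) = cos \<theta> * fst p - sin \<theta> * snd p"
  "snd (rot \<theta> p) = sin \<theta> * fst p + cos \<theta> * snd p"
  by (simp_all add: rot_def)

lemma linear_rot: "linear (rot \<theta>)"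
  by (rule linearI) (simp_all add: rot_def algebra_simps)

lemmas has_derivative_rot = linear_imp_has_derivative[OF linear_rot]

lemma continuous_on_rot: "continuous_on X (rot \<theta>)"
  by (simp add: linear_rot linear_continuous_on linear_linear)

lemma rot_rot: "rot a (rot b p) = rot (a + b) p"
  by (simp add: rot_def sin_add cos_add algebra_simps)

lemma rot_0 [simp]: "rot 0 p = p"
  by (simp add: rot_def)

lemma rot_minus_cancel [simp]: "rot (- \<theta>) (rot \<theta> p) = p" "rot \<theta> (rot (- \<theta>) p) = p"
  by (simp_all add: rot_rot)

lemma inner_rot: "rot \<theta> p \<bullet> q = p \<bullet> rot (- \<theta>) q"
  by (simp add: inner_prod_def algebra_simps)

lemma inner_rot_rot [simp]: "rot \<theta> p \<bullet> rot \<theta> q = p \<bullet> q"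
  by (simp add: inner_rot)

lemma vimage_rot: "rot \<theta> -` A = rot (- \<theta>) ` A"
proof (intro equalityI subsetI)
  show "x \<in> rot (- \<theta>) ` A" if "x \<in> rot \<theta> -` A" for x
    using that by (intro image_eqI[of _ _ "rot \<theta> x"]) auto
qed auto

text \<open>A preimage under a rotation is the image under the inverse rotation, and injective
  linear maps of the plane commute with closure.\<close>

lemma closure_vimage_rot: "closure (rot \<theta> -` A) = rot \<theta> -` closure A"
proof -
  have "inj (rot (- \<theta>))"
    by (metis injI rot_minus_cancel(2))
  then show ?thesis
    unfolding vimage_rot by (rule closure_injective_linear_image[OF linear_rot, symmetric])
qed

lemma open_vimage_rot: "open A \<Longrightarrow> open (rot \<theta> -` A)"
  using continuous_on_rot by (rule open_vimage[rotated])

lemma rotate_coords_simps [simp]: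
  "Omega_minus (rotate_coords \<theta> S) = rot \<theta> -` Omega_minus S"
  "Omega_plus (rotate_coords \<theta> S) = rot \<theta> -` Omega_plus S"
  "phi_minus (rotate_coords \<theta> S) = phi_minus S \<circ> rot \<theta>"
  "phi_plus (rotate_coords \<theta> S) = phi_plus S \<circ> rot \<theta>"
  "Gamma_sonic (rotate_coords \<theta> S) = rot \<theta> -` Gamma_sonic S"
  by (simp_all add: rotate_coords_def)

lemma rotate_coords_add: "rotate_coords b (rotate_coords a S) = rotate_coords (a + b) S"
  by (simp add: rotate_coords_def vimage_def rot_rot comp_def)

text \<open>By the chain rule, \<open>rot_vec\<close> and \<open>rot_op\<close> produce the gradient
  and the Hessian of \<open>\<phi> \<circ> rot \<theta>\<close> from those of \<open>\<phi>\<close>;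
  the transpose of a rotation is the rotation by the opposite angle.\<close>

definition rot_vec where "rot_vec \<theta> g = (\<lambda>p. rot (- \<theta>) (g (rot \<theta> p)))"
definition rot_op where "rot_op \<theta> H = (\<lambda>p v. rot (- \<theta>) (H (rot \<theta> p) (rot \<theta> v)))"

lemma has_derivative_comp_rot:
  assumes "(u has_derivative D) (at (rot \<theta> p) within B)"
  shows "((\<lambda>q. u (rot \<theta> q)) has_derivative (\<lambda>v. D (rot \<theta> v))) (at p within rot \<theta> -` B)"
  by (rule has_derivative_in_compose[OF has_derivative_rot])
     (rule has_derivative_subset[OF assms], auto)

lemma has_derivative_comp_rot_at:
  assumes "(u has_derivative D) (at (rot \<theta> p))"
  shows "((\<lambda>q. u (rot \<theta> q)) has_derivative (\<lambda>v. D (rot \<theta> v))) (at p)"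
  using has_derivative_comp_rot[OF assms] by simp

lemma (in c2_side) c2_side_rot:
  "c2_side (rot \<theta> -` A) (rot \<theta> -` B) (\<phi> \<circ> rot \<theta>) (rot_vec \<theta> g) (rot_op \<theta> H)"
proof (rule c2_side.intro)
  have *: "continuous_on (rot \<theta> -` B) (\<lambda>p. f (rot \<theta> p))"
    if "continuous_on B f" for f :: "_ \<Rightarrow> 'z::topological_space"
    by (rule continuous_on_compose2[OF that continuous_on_rot]) auto
  show "continuous_on (rot \<theta> -` B) (\<phi> \<circ> rot \<theta>)"
    unfolding comp_def by (rule * [OF cont_\<phi>])
  show "continuous_on (rot \<theta> -` B) (rot_vec \<theta> g)"
    unfolding rot_vec_def by (rule continuous_on_compose2[OF continuous_on_rot * [OF cont_g]]) auto
  show "continuous_on (rot \<theta> -` B) (\<lambda>p. rot_op \<theta> H p v)" for v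
    unfolding rot_op_def by (rule continuous_on_compose2[OF continuous_on_rot * [OF cont_H]]) auto
  show "open (rot \<theta> -` A)" using open_A by (rule open_vimage_rot)
  show "rot \<theta> -` A \<subseteq> rot \<theta> -` B" using A_sub_B by auto
  show "rot \<theta> -` B \<subseteq> closure (rot \<theta> -` A)" using B_sub_closure by (auto simp: closure_vimage_rot)
next
  fix p assume p: "p \<in> rot \<theta> -` B"
  then show "linear (rot_op \<theta> H p)"
    using linear_compose[OF linear_rot linear_compose[OF linear_H linear_rot]]
    by (simp add: rot_op_def comp_def)
  show "v \<bullet> rot_op \<theta> H p w = w \<bullet> rot_op \<theta> H p v" for v w
    using p symmetric_H[of "rot \<theta> p" "rot \<theta> v" "rot \<theta> w"]
    by (simp add: rot_op_def inner_rot inner_commute[of _ "rot (- \<theta>) _"])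
next
  fix p assume p: "p \<in> rot \<theta> -` A"
  show "(\<phi> \<circ> rot \<theta> has_derivative (\<lambda>v. rot_vec \<theta> g p \<bullet> v)) (at p)"
    using has_derivative_comp_rot_at[OF deriv_\<phi>[of "rot \<theta> p"]] p
    by (simp add: comp_def rot_vec_def inner_rot)
  show "(rot_vec \<theta> g has_derivative rot_op \<theta> H p) (at p)"
    unfolding rot_vec_def rot_op_def
    using has_derivative_compose[OF has_derivative_comp_rot_at[OF deriv_g] has_derivative_rot] p
    by auto
qed

abbreviation trace_op :: "(real \<times> real \<Rightarrow> real \<times> real) \<Rightarrow> real" where
  "trace_op h \<equiv> (1, 0) \<bullet> h (1, 0) + (0, 1) \<bullet> h (0, 1)"

text \<open>The trace is invariant under conjugation by an orthogonal map; expanded by columns, this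
  is cos^2 + sin^2 = 1.\<close>

lemma (in c2_side) trace_op_rot:
  assumes "rot \<theta> p \<in> B"
  shows "trace_op (rot_op \<theta> H p) = trace_op (H (rot \<theta> p))"
proof -
  let ?a = "H (rot \<theta> p) (1, 0)" and ?b = "H (rot \<theta> p) (0, 1)"
  have "trace_op (rot_op \<theta> H p) = rot \<theta> (1, 0) \<bullet> H (rot \<theta> p) (rot \<theta> (1, 0))
      + rot \<theta> (0, 1) \<bullet> H (rot \<theta> p) (rot \<theta> (0, 1))"
    by (simp add: rot_op_def inner_rot)
  also have "\<dots> = ((cos \<theta>)\<^sup>2 + (sin \<theta>)\<^sup>2) * (fst ?a + snd ?b)"
    unfolding H_components[OF assms, of "rot \<theta> (1, 0)"] H_components[OF assms, of "rot \<theta> (0, 1)"]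
      inner_prod_def rot_components fst_add snd_add fst_scaleR snd_scaleR inner_real_def real_scaleR_def
      fst_conv snd_conv
    by algebra
  finally show ?thesis by (simp add: inner_prod_def)
qed

section \<open>The flow equation in non-divergence form\<close>

definition sound_sq :: "real \<Rightarrow> real \<Rightarrow> real \<Rightarrow> real \<times> real \<Rightarrow> real" where
  "sound_sq \<gamma> K z w = (\<gamma> - 1) * (K - z - (w \<bullet> w) / 2)"

lemma sonic_speed_eq: "sonic_speed \<gamma> K z w = sqrt (sound_sq \<gamma> K z w)"
  by (simp add: sonic_speed_def bernoulli_def sound_sq_def power2_norm_eq_inner)

lemma sound_sq_rot [simp]: "sound_sq \<gamma> K z (rot \<theta> w) = sound_sq \<gamma> K z w"
  by (simp add: sound_sq_def)

text \<open>With \<open>trace_op (H p)\<close> the Laplacian, \<open>flow_eq\<close> is the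
  non-divergence form of the potential flow equation. It is stated where c^2 > 0, since there the
  power that defines the density can be differentiated by the usual rule.\<close>

locale sonic_side = c2_side A B \<phi> g H for A B \<phi> g H +
  fixes \<gamma> K :: real
  assumes flow_eq: "\<lbrakk>p \<in> A; sound_sq \<gamma> K (\<phi> p) (g p) > 0\<rbrakk> \<Longrightarrow>
    sound_sq \<gamma> K (\<phi> p) (g p) * (trace_op (H p) + 2) = g p \<bullet> g p + g p \<bullet> H p (g p)"

lemma (in sonic_side) sonic_side_rot:
  "sonic_side (rot \<theta> -` A) (rot \<theta> -` B) (\<phi> \<circ> rot \<theta>) (rot_vec \<theta> g) (rot_op \<theta> H) \<gamma> K"
proof (intro sonic_side.intro c2_side_rot sonic_side_axioms.intro)
  fix p assume p: "p \<in> rot \<theta> -` A" and c: "sound_sq \<gamma> K ((\<phi> \<circ> rot \<theta>) p) (rot_vec \<theta> g p) > 0"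
  have "rot_vec \<theta> g p \<bullet> rot_op \<theta> H p (rot_vec \<theta> g p) = g (rot \<theta> p) \<bullet> H (rot \<theta> p) (g (rot \<theta> p))"
    by (simp add: rot_vec_def rot_op_def)
  moreover have "rot_vec \<theta> g p \<bullet> rot_vec \<theta> g p = g (rot \<theta> p) \<bullet> g (rot \<theta> p)"
    by (simp add: rot_vec_def)
  ultimately show "sound_sq \<gamma> K ((\<phi> \<circ> rot \<theta>) p) (rot_vec \<theta> g p) * (trace_op (rot_op \<theta> H p) + 2)
    = rot_vec \<theta> g p \<bullet> rot_vec \<theta> g p + rot_vec \<theta> g p \<bullet> rot_op \<theta> H p (rot_vec \<theta> g p)"
    using flow_eq[of "rot \<theta> p"] trace_op_rot[of \<theta> p] p c A_sub_B by (auto simp: rot_vec_def)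
qed

lemma (in c2_side) deriv_sound_sq:
  assumes "p \<in> A"
  shows "((\<lambda>q. sound_sq \<gamma> K (\<phi> q) (g q)) has_derivative
    (\<lambda>v. - (\<gamma> - 1) * (g p \<bullet> v + g p \<bullet> H p v))) (at p)"
  unfolding sound_sq_def
  by (rule derivative_eq_intros deriv_\<phi>[OF assms] deriv_g[OF assms] refl)+
     (auto simp: algebra_simps inner_commute)

text \<open>Expanding div(\<rho> D\<phi>) gives \<rho> times the Laplacian plus the product of
  D\<rho> and D\<phi>, and the Bernoulli relation gives D\<rho> = - (\<rho> / c^2) (D\<phi> +
  D^2\<phi> D\<phi>). Multiplication by c^2 / \<rho> yields the claim.\<close>

lemma (in c2_side) flow_eq_nondivergence:
  assumes \<gamma>: "\<gamma> > 1" and flow: "potential_flow_on \<gamma> K A \<phi>"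
    and p: "p \<in> A" and pos: "sound_sq \<gamma> K (\<phi> p) (g p) > 0"
  shows "sound_sq \<gamma> K (\<phi> p) (g p) * (trace_op (H p) + 2) = g p \<bullet> g p + g p \<bullet> H p (g p)"
proof -
  define b where "b = (\<lambda>q. sound_sq \<gamma> K (\<phi> q) (g q) / (\<gamma> - 1))"
  define \<rho> where "\<rho> = (\<lambda>q. b q powr (1 / (\<gamma> - 1)))"
  \<comment> \<open>The derivative of the power function at \<open>b p\<close>; it equals \<rho> /
    c^2 because c^2 = (\<gamma> - 1) b.\<close>
  define \<kappa> where "\<kappa> = \<rho> p / ((\<gamma> - 1) * b p)"
  have b: "b p > 0" using pos \<gamma> by (simp add: b_def)
  have \<rho>: "\<rho> p > 0" using b by (simp add: \<rho>_def)
  have Db: "(b has_derivative (\<lambda>v. - (g p \<bullet> v + g p \<bullet> H p v))) (at p)"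
    unfolding b_def
    by (rule derivative_eq_intros deriv_sound_sq[OF p] refl)+ (use \<gamma> in \<open>auto simp: field_simps\<close>)
  have powr: "((\<lambda>x. x powr (1 / (\<gamma> - 1))) has_derivative (*) \<kappa>) (at (b p))"
  proof -
    have "((\<lambda>x. x powr (1 / (\<gamma> - 1))) has_real_derivative
        (1 / (\<gamma> - 1)) * b p powr (1 / (\<gamma> - 1) - 1)) (at (b p))"
      using b by (rule has_real_derivative_powr)
    moreover have "(1 / (\<gamma> - 1)) * b p powr (1 / (\<gamma> - 1) - 1) = \<kappa>"
      using b by (simp add: \<kappa>_def \<rho>_def powr_diff)
    ultimately show ?thesis by (simp add: has_field_derivative_def)
  qed
  have D\<rho>: "(\<rho> has_derivative (\<lambda>v. - \<kappa> * (g p \<bullet> v + g p \<bullet> H p v))) (at p)"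
    using has_derivative_compose[OF Db powr] by (simp add: \<rho>_def algebra_simps)
  have dens: "density \<gamma> K (\<phi> q) (grad \<phi> q) = \<rho> q" if "q \<in> A" for q
    using grad_eq[OF that] \<gamma>
    by (simp add: density_def bernoulli_def \<rho>_def b_def sound_sq_def power2_norm_eq_inner)
  have DU: "((\<lambda>q. density \<gamma> K (\<phi> q) (grad \<phi> q) * d_xi \<phi> q) has_derivative
      (\<lambda>v. \<rho> p * fst (H p v) + - \<kappa> * (g p \<bullet> v + g p \<bullet> H p v) * fst (g p))) (at p)"
  proof (rule has_derivative_transform_within_open[OF _ open_A p])
    show "((\<lambda>q. \<rho> q * fst (g q)) has_derivative
      (\<lambda>v. \<rho> p * fst (H p v) + - \<kappa> * (g p \<bullet> v + g p \<bullet> H p v) * fst (g p))) (at p)"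
      by (intro has_derivative_mult D\<rho> has_derivative_fst deriv_g p)
  qed (simp add: dens d_xi_eq)
  have DV: "((\<lambda>q. density \<gamma> K (\<phi> q) (grad \<phi> q) * d_eta \<phi> q) has_derivative
      (\<lambda>v. \<rho> p * snd (H p v) + - \<kappa> * (g p \<bullet> v + g p \<bullet> H p v) * snd (g p))) (at p)"
  proof (rule has_derivative_transform_within_open[OF _ open_A p])
    show "((\<lambda>q. \<rho> q * snd (g q)) has_derivative
      (\<lambda>v. \<rho> p * snd (H p v) + - \<kappa> * (g p \<bullet> v + g p \<bullet> H p v) * snd (g p))) (at p)"
      by (intro has_derivative_mult D\<rho> has_derivative_snd deriv_g p)
  qed (simp add: dens d_eta_eq)
  have pB: "p \<in> B" using p A_sub_B by auto
  have Hg: "g p \<bullet> H p (g p) = fst (g p) * (g p \<bullet> H p (1, 0)) + snd (g p) * (g p \<bullet> H p (0, 1))"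
    by (subst H_components[OF pB, of "g p"]) (simp add: inner_add_right)
  have "d_xi (\<lambda>q. density \<gamma> K (\<phi> q) (grad \<phi> q) * d_xi \<phi> q) p
      + d_eta (\<lambda>q. density \<gamma> K (\<phi> q) (grad \<phi> q) * d_eta \<phi> q) p
      + 2 * density \<gamma> K (\<phi> p) (grad \<phi> p) = 0"
    using flow p by (simp add: potential_flow_on_def Let_def)
  then have "\<rho> p * (trace_op (H p) + 2) - \<kappa> * (g p \<bullet> g p + g p \<bullet> H p (g p)) = 0"
    unfolding partials_of_has_derivative[OF DU] partials_of_has_derivative[OF DV] dens[OF p] Hg
    by (simp add: inner_prod_def algebra_simps)
  then have "\<rho> p * ((\<gamma> - 1) * b p) * (trace_op (H p) + 2) = \<rho> p * (g p \<bullet> g p + g p \<bullet> H p (g p))"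
    using b \<gamma> by (simp add: \<kappa>_def field_simps)
  then show ?thesis using \<rho> \<gamma> by (simp add: b_def)
qed

section \<open>One-sided derivatives at the boundary of a graph\<close>

text \<open>The mean value inequality for \<open>u - T\<close> along the segment. Differentiability
  is asked only between the end points, so that these may lie on the boundary of a region.\<close>

lemma segment_linear_approx:
  fixes u :: "'a::real_normed_vector \<Rightarrow> 'b::real_inner"
  assumes cont: "continuous_on (closed_segment a b) u"
    and deriv: "\<And>q. q \<in> open_segment a b \<Longrightarrow> (u has_derivative D q) (at q)"
    and close: "\<And>q. q \<in> open_segment a b \<Longrightarrow> norm (D q (b - a) - T (b - a)) \<le> \<epsilon>"
    and T: "bounded_linear T" and \<epsilon>: "0 \<le> \<epsilon>"
  shows "norm (u b - u a - T (b - a)) \<le> \<epsilon>"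
proof (cases "a = b")
  case True
  interpret bounded_linear T by (rule T)
  show ?thesis using True \<epsilon> by (simp add: zero)
next
  case False
  interpret T: bounded_linear T by (rule T)
  define l where "l = (\<lambda>t. a + t *\<^sub>R (b - a))"
  have seg: "l t = (1 - t) *\<^sub>R a + t *\<^sub>R b" for t by (simp add: l_def algebra_simps)
  have in_open: "l t \<in> open_segment a b" if "0 < t" "t < 1" for t
    using that False by (auto simp: in_segment seg)
  have "\<exists>t\<in>{0<..<1}. norm ((u (l 1) - T (l 1)) - (u (l 0) - T (l 0)))
      \<le> norm (D (l t) ((1 - 0) *\<^sub>R (b - a)) - T ((1 - 0) *\<^sub>R (b - a)))"
  proof (rule mvt_general)
    have "continuous_on {0..1} l" unfolding l_def by (intro continuous_intros)
    moreover have "l ` {0..1} \<subseteq> closed_segment a b" by (auto simp: in_segment seg)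
    ultimately show "continuous_on {0..1} (\<lambda>t. u (l t) - T (l t))"
      using cont by (intro continuous_intros continuous_on_compose2[OF cont] T.continuous_on) auto
  next
    fix t :: real assume t: "0 < t" "t < 1"
    have "(l has_derivative (\<lambda>s. s *\<^sub>R (b - a))) (at t)"
      unfolding l_def by (auto intro!: derivative_eq_intros)
    then show "((\<lambda>t. u (l t) - T (l t)) has_derivative
        (\<lambda>s. D (l t) (s *\<^sub>R (b - a)) - T (s *\<^sub>R (b - a)))) (at t)"
      by (intro has_derivative_diff T.has_derivative
          has_derivative_compose[of l _ t UNIV u "D (l t)"] deriv in_open t)
  qed simp
  then obtain t where t: "0 < t" "t < 1"
    and le: "norm ((u b - T b) - (u a - T a)) \<le> norm (D (l t) (b - a) - T (b - a))"
    by (auto simp: l_def)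
  have "norm (D (l t) (b - a) - T (b - a)) \<le> \<epsilon>"
    by (rule close[OF in_open[OF t]])
  with le show ?thesis by (simp add: T.diff algebra_simps)
qed

text \<open>The sign \<open>\<sigma>\<close> selects the side of the graph. A point \<open>p\<close> on that side at distance \<open>\<delta>\<close> from
  \<open>Q\<close> is joined to \<open>Q\<close> through \<open>Q + (0, 2 \<sigma> L \<delta>)\<close>, since by the Lipschitz condition both segments
  stay strictly on the side of the graph.\<close>

lemma has_derivative_at_graph_boundary:
  fixes u :: "real \<times> real \<Rightarrow> 'a::real_inner" and f :: "real \<Rightarrow> real"
  assumes r: "r > 0" and L: "L > 0" and \<sigma>: "\<sigma> = 1 \<or> \<sigma> = -1"
    and lip: "\<And>x y. \<lbrakk>\<bar>x - x0\<bar> < r; \<bar>y - x0\<bar> < r\<rbrakk> \<Longrightarrow> \<bar>f x - f y\<bar> \<le> L * \<bar>x - y\<bar>"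
    and Q: "Q = (x0, f x0)" "Q \<in> B"
    and side_A: "\<And>x y. \<lbrakk>(x, y) \<in> ball Q r; \<sigma> * y > \<sigma> * f x\<rbrakk> \<Longrightarrow> (x, y) \<in> A"
    and side_B: "\<And>x y. \<lbrakk>(x, y) \<in> ball Q r; (x, y) \<in> B\<rbrakk> \<Longrightarrow> \<sigma> * y \<ge> \<sigma> * f x"
    and AB: "A \<subseteq> B"
    and cont: "continuous_on B u"
    and deriv: "\<And>p. p \<in> A \<Longrightarrow> (u has_derivative D p) (at p)"
    and lin: "linear T"
    and lim: "\<And>v. ((\<lambda>p. D p v) \<longlongrightarrow> T v) (at Q within A)"
  shows "(u has_derivative T) (at Q within B)"
proof -
  have T: "bounded_linear T" using lin by (simp add: linear_linear)
  interpret T: bounded_linear T by (rule T)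
  have "\<exists>d>0. \<forall>p\<in>B. norm (p - Q) < d \<longrightarrow> norm (u p - u Q - T (p - Q)) \<le> e * norm (p - Q)"
    if e: "e > 0" for e
  proof -
    \<comment> \<open>The two segments have total length at most
      \<open>(1 + 4 * L) * \<delta>\<close>, and the errors of the two partial derivatives add up to
      a factor 2; the total error is then \<open>e * \<delta>\<close>.\<close>
    define \<epsilon> where "\<epsilon> = e / (2 * (1 + 4 * L))"
    have \<epsilon>: "\<epsilon> > 0" using e L by (simp add: \<epsilon>_def)
    have "\<forall>\<^sub>F p in at Q within A. dist (D p (1, 0)) (T (1, 0)) < \<epsilon> \<and> dist (D p (0, 1)) (T (0, 1)) < \<epsilon>"
      by (intro eventually_conj tendstoD lim \<epsilon>)
    then obtain d where d: "d > 0"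
      "\<And>p. \<lbrakk>p \<in> A; p \<noteq> Q; dist p Q < d\<rbrakk> \<Longrightarrow>
        dist (D p (1, 0)) (T (1, 0)) < \<epsilon> \<and> dist (D p (0, 1)) (T (0, 1)) < \<epsilon>"
      unfolding eventually_at by blast
    have close: "norm (D p v - T v) \<le> 2 * \<epsilon> * norm v" if p: "p \<in> A" "p \<noteq> Q" "dist p Q < d" for p v
    proof -
      interpret D: linear "D p" by (rule has_derivative_linear[OF deriv[OF p(1)]])
      have v: "v = fst v *\<^sub>R (1, 0) + snd v *\<^sub>R (0, 1)" by (cases v) auto
      have "D p v - T v = fst v *\<^sub>R (D p (1, 0) - T (1, 0)) + snd v *\<^sub>R (D p (0, 1) - T (0, 1))"
        by (subst (1 2) v) (simp only: D.add D.scale T.add T.scaleR algebra_simps)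
      also have "norm \<dots> \<le> \<bar>fst v\<bar> * norm (D p (1, 0) - T (1, 0)) + \<bar>snd v\<bar> * norm (D p (0, 1) - T (0, 1))"
        by (rule norm_triangle_le) simp
      also have "\<dots> \<le> norm v * \<epsilon> + norm v * \<epsilon>"
        using d(2)[OF p] norm_fst_le[of "fst v" "snd v"] norm_snd_le[of "snd v" "fst v"]
        by (intro add_mono mult_mono) (auto simp: dist_norm)
      finally show ?thesis by (simp add: algebra_simps)
    qed
    \<comment> \<open>Both segments stay within distance \<open>(1 + 2 * L) * \<delta>\<close> of
      \<open>Q\<close>; for \<open>\<delta> < s\<close> this is below \<open>d\<close> and
      \<open>r\<close>.\<close>
    define s where "s = min d r / (1 + 2 * L)"
    have s: "s > 0" "s \<le> d" "s \<le> r" "(1 + 2 * L) * s \<le> d" "(1 + 2 * L) * s \<le> r"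
    proof -
      show "s > 0" using d r L by (simp add: s_def)
      have "(1 + 2 * L) * s = min d r" using L by (simp add: s_def)
      moreover have "s \<le> (1 + 2 * L) * s" using \<open>s > 0\<close> L by simp
      ultimately show "s \<le> d" "s \<le> r" "(1 + 2 * L) * s \<le> d" "(1 + 2 * L) * s \<le> r" by linarith+
    qed
    show ?thesis
    proof (intro exI[of _ s] conjI ballI impI s)
      fix p assume p: "p \<in> B" "norm (p - Q) < s"
      define \<delta> where "\<delta> = norm (p - Q)"
      show "norm (u p - u Q - T (p - Q)) \<le> e * norm (p - Q)"
      proof (cases "\<delta> = 0")
        case True
        then show ?thesis by (simp add: \<delta>_def T.zero)
      next
        case False
        then have \<delta>: "\<delta> > 0" "\<delta> < s" using p by (auto simp: \<delta>_def)
        obtain x y where xy: "p = (x, y)" by (cases p)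
        define M where "M = Q + (0, 2 * \<sigma> * L * \<delta>)"
        have M: "M = (x0, f x0 + 2 * \<sigma> * L * \<delta>)" by (simp add: M_def Q)
        have \<sigma>\<sigma>: "\<sigma> * \<sigma> = 1" using \<sigma> by auto
        have nM: "norm (M - Q) = 2 * L * \<delta>"
          using \<sigma> L \<delta> by (auto simp: M_def norm_Pair abs_mult)
        have "norm (p - M) \<le> norm (p - Q) + norm (M - Q)"
          by (rule norm_triangle_le_diff[of "p - Q" "M - Q", simplified]) simp
        then have npM: "norm (p - M) \<le> (1 + 2 * L) * \<delta>"
          using nM by (simp add: \<delta>_def algebra_simps)
        have \<delta>s: "(1 + 2 * L) * \<delta> < (1 + 2 * L) * s" using \<delta> L by simp
        have xdist: "\<bar>x - x0\<bar> \<le> \<delta>"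
          using norm_fst_le[of "x - x0" "y - f x0"] by (simp add: \<delta>_def xy Q)
        have py: "\<sigma> * y \<ge> \<sigma> * f x"
        proof (rule side_B)
          show "(x, y) \<in> ball Q r" using \<delta> s by (simp add: xy[symmetric] \<delta>_def dist_norm norm_minus_commute)
        qed (use p xy in auto)
        have inball: "dist q Q < d \<and> dist q Q < r"
          if q: "q \<in> closed_segment Q M \<or> q \<in> closed_segment M p" for q
        proof -
          have "closed_segment a b \<subseteq> cball Q ((1 + 2 * L) * \<delta>)"
            if "a \<in> cball Q ((1 + 2 * L) * \<delta>)" "b \<in> cball Q ((1 + 2 * L) * \<delta>)" for a b
            using that by (rule closed_segment_subset) simp
          moreover have "Q \<in> cball Q ((1 + 2 * L) * \<delta>)" "M \<in> cball Q ((1 + 2 * L) * \<delta>)"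
            "p \<in> cball Q ((1 + 2 * L) * \<delta>)"
            using L \<delta>(1) nM by (simp_all add: dist_norm norm_minus_commute[of Q] algebra_simps flip: \<delta>_def)
          ultimately have "q \<in> cball Q ((1 + 2 * L) * \<delta>)" using q by blast
          then show ?thesis using \<delta>s s by (simp add: dist_commute)
        qed
        have seg1: "q \<in> A \<and> q \<noteq> Q" if q: "q \<in> open_segment Q M" for q
        proof -
          obtain t where t: "0 < t" "t < 1" "q = (1 - t) *\<^sub>R Q + t *\<^sub>R M"
            using q by (auto simp: in_segment)
          then have qe: "q = (x0, f x0 + 2 * t * \<sigma> * L * \<delta>)" by (simp add: Q M algebra_simps)
          have "q \<in> closed_segment Q M" using q open_closed_segment by blast
          then have "(x0, f x0 + 2 * t * \<sigma> * L * \<delta>) \<in> ball Q r"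
            using inball[of q] qe by (simp add: dist_commute)
          moreover have "\<sigma> * (f x0 + 2 * t * \<sigma> * L * \<delta>) = \<sigma> * f x0 + 2 * t * L * \<delta>"
            using \<sigma>\<sigma> by algebra
          moreover have "0 < 2 * t * L * \<delta>" using t L \<delta> by simp
          ultimately have "q \<in> A" unfolding qe by (intro side_A) simp_all
          then show ?thesis using q by (auto simp: open_segment_def)
        qed
        have seg2: "q \<in> A \<and> q \<noteq> Q" if q: "q \<in> open_segment M p" for q
        proof -
          obtain t where t: "0 < t" "t < 1" "q = (1 - t) *\<^sub>R M + t *\<^sub>R p"
            using q by (auto simp: in_segment)
          define x1 y1 where "x1 = x0 + t * (x - x0)"
            and "y1 = (1 - t) * (f x0 + 2 * \<sigma> * L * \<delta>) + t * y"
          have qe: "q = (x1, y1)" by (simp add: t(3) M xy x1_def y1_def algebra_simps)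
          have "q \<in> closed_segment M p" using q open_closed_segment by blast
          then have ball: "(x1, y1) \<in> ball Q r" using inball[of q] qe by (simp add: dist_commute)
          have "t * \<bar>x - x0\<bar> \<le> 1 * \<bar>x - x0\<bar>" using t by (intro mult_right_mono) auto
          then have x1: "\<bar>x1 - x0\<bar> < r" "\<bar>x - x0\<bar> < r"
            using t xdist \<delta> s by (auto simp: x1_def abs_mult)
          have "\<bar>f x1 - f x0\<bar> \<le> L * \<bar>x1 - x0\<bar>" using lip x1 r by simp
          also have "\<dots> \<le> L * (t * \<delta>)" using t xdist L by (simp add: x1_def abs_mult mult_left_mono)
          finally have l0: "\<bar>f x1 - f x0\<bar> \<le> L * (t * \<delta>)" .
          have "\<bar>f x1 - f x\<bar> \<le> L * \<bar>x1 - x\<bar>" using lip x1 by simp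
          also have "x1 - x = (t - 1) * (x - x0)" by (simp add: x1_def algebra_simps)
          also have "L * \<bar>\<dots>\<bar> \<le> L * ((1 - t) * \<delta>)"
            using t xdist L by (simp add: abs_mult mult_left_mono)
          finally have l1: "\<bar>f x1 - f x\<bar> \<le> L * ((1 - t) * \<delta>)" .
          have s0: "\<sigma> * (f x1 - f x0) \<le> L * (t * \<delta>)" and s1: "\<sigma> * (f x1 - f x) \<le> L * ((1 - t) * \<delta>)"
            using \<sigma> l0 l1 by auto
          \<comment> \<open>\<open>f x1\<close> is split with weights \<open>1 - t\<close> and
            \<open>t\<close> and compared with \<open>f x0\<close> and \<open>f x\<close>. The
            Lipschitz errors sum to \<open>t * ((1 - t) * (2 * L * \<delta>))\<close>, strictly less
            than the height \<open>(1 - t) * (2 * L * \<delta>)\<close> that the point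
            \<open>M\<close> contributes.\<close>
          have "\<sigma> * f x1 = (1 - t) * (\<sigma> * f x0 + \<sigma> * (f x1 - f x0)) + t * (\<sigma> * f x + \<sigma> * (f x1 - f x))"
            by (simp add: algebra_simps)
          also have "\<dots> \<le> (1 - t) * (\<sigma> * f x0 + L * (t * \<delta>)) + t * (\<sigma> * y + L * ((1 - t) * \<delta>))"
          proof (intro add_mono)
            show "(1 - t) * (\<sigma> * f x0 + \<sigma> * (f x1 - f x0)) \<le> (1 - t) * (\<sigma> * f x0 + L * (t * \<delta>))"
              by (rule mult_left_mono) (use t s0 in auto)
            show "t * (\<sigma> * f x + \<sigma> * (f x1 - f x)) \<le> t * (\<sigma> * y + L * ((1 - t) * \<delta>))"
              by (rule mult_left_mono[OF add_mono[OF py s1]]) (use t in auto)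
          qed
          also have "\<dots> = (1 - t) * \<sigma> * f x0 + t * \<sigma> * y + t * ((1 - t) * (2 * L * \<delta>))"
            by (simp add: algebra_simps)
          also have "\<dots> < (1 - t) * \<sigma> * f x0 + t * \<sigma> * y + 1 * ((1 - t) * (2 * L * \<delta>))"
            using t L \<delta> by (intro add_strict_left_mono mult_strict_right_mono) auto
          also have "\<dots> = \<sigma> * y1" using \<sigma>\<sigma> unfolding y1_def by algebra
          finally have "\<sigma> * f x1 < \<sigma> * y1" .
          then have "q \<in> A" using side_A ball by (simp add: qe)
          moreover have "q \<noteq> Q" using \<open>\<sigma> * f x1 < \<sigma> * y1\<close> by (auto simp: qe Q)
          ultimately show ?thesis by simp
        qed
        have "M \<in> A"
        proof -
          have "M \<in> ball Q r" using inball[of M] by (simp add: dist_commute)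
          moreover have "\<sigma> * (f x0 + 2 * \<sigma> * L * \<delta>) = \<sigma> * f x0 + 2 * L * \<delta>" using \<sigma>\<sigma> by algebra
          ultimately show ?thesis using side_A[of x0 "f x0 + 2 * \<sigma> * L * \<delta>"] L \<delta> by (simp add: M)
        qed
        then have cseg: "closed_segment Q M \<subseteq> B" "closed_segment M p \<subseteq> B"
          using seg1 seg2 AB p(1) Q(2) by (auto simp: closed_segment_eq_open)
        have b1: "norm (u M - u Q - T (M - Q)) \<le> 2 * \<epsilon> * norm (M - Q)"
        proof (rule segment_linear_approx[OF continuous_on_subset[OF cont cseg(1)] _ _ T])
          fix q assume q: "q \<in> open_segment Q M"
          then have "q \<in> closed_segment Q M" using open_closed_segment by blast
          then show "(u has_derivative D q) (at q)"
            "norm (D q (M - Q) - T (M - Q)) \<le> 2 * \<epsilon> * norm (M - Q)"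
            using seg1[OF q] inball[of q] by (auto intro: deriv close)
        qed (use \<epsilon> in simp)
        have b2: "norm (u p - u M - T (p - M)) \<le> 2 * \<epsilon> * norm (p - M)"
        proof (rule segment_linear_approx[OF continuous_on_subset[OF cont cseg(2)] _ _ T])
          fix q assume q: "q \<in> open_segment M p"
          then have "q \<in> closed_segment M p" using open_closed_segment by blast
          then show "(u has_derivative D q) (at q)"
            "norm (D q (p - M) - T (p - M)) \<le> 2 * \<epsilon> * norm (p - M)"
            using seg2[OF q] inball[of q] by (auto intro: deriv close)
        qed (use \<epsilon> in simp)
        have "u p - u Q - T (p - Q) = (u p - u M - T (p - M)) + (u M - u Q - T (M - Q))"
          by (simp add: T.diff)
        also have "norm \<dots> \<le> 2 * \<epsilon> * norm (p - M) + 2 * \<epsilon> * norm (M - Q)"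
          using b1 b2 by (intro norm_triangle_le add_mono)
        also have "\<dots> \<le> 2 * \<epsilon> * ((1 + 2 * L) * \<delta>) + 2 * \<epsilon> * (2 * L * \<delta>)"
          using npM nM \<epsilon> by (intro add_mono mult_left_mono) auto
        also have "\<dots> = \<epsilon> * (2 * (1 + 4 * L)) * \<delta>" by (simp add: algebra_simps)
        also have "\<dots> = e * \<delta>" using L by (simp add: \<epsilon>_def)
        finally show ?thesis by (simp add: \<delta>_def)
      qed
    qed
  qed
  then show ?thesis using T by (auto simp: has_derivative_within_alt)
qed

section \<open>The flow at a sonic point\<close>

text \<open>This is |D\<phi>|^2 - c^2, positive in the supersonic and negative in the subsonic
  region. Free of square roots, it is differentiable together with \<phi> and D\<phi>.\<close>

definition excess :: "real \<Rightarrow> real \<Rightarrow> real \<Rightarrow> real \<times> real \<Rightarrow> real" where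
  "excess \<gamma> K z w = w \<bullet> w - sound_sq \<gamma> K z w"

lemma excess_rot [simp]: "excess \<gamma> K z (rot \<theta> w) = excess \<gamma> K z w"
  by (simp add: excess_def)

text \<open>Both sides of the configuration, with traces replaced by explicit extensions of gradient
  and Hessian. All conditions are invariant under rotation, so the structure passes to rotated
  axes.\<close>

locale sonic_pair =
  minus: sonic_side "Omega_minus S" "closure (Omega_minus S)" "phi_minus S" gm Hm \<gamma> K +
  plus: sonic_side "Omega_plus S" "Omega_plus S \<union> Gamma_sonic S" "phi_plus S" gp Hp \<gamma> K
  for \<gamma> K and S :: sonic_flow and gm Hm gp Hp +
  assumes gamma_gt_1: "\<gamma> > 1"
    and disjoint: "Omega_minus S \<inter> Omega_plus S = {}"
    and Gamma_closure: "Gamma_sonic S \<subseteq> closure (Omega_minus S)"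
    and excess_minus: "p \<in> Omega_minus S \<Longrightarrow> excess \<gamma> K (phi_minus S p) (gm p) > 0"
    and excess_plus: "p \<in> Omega_plus S \<Longrightarrow> excess \<gamma> K (phi_plus S p) (gp p) < 0"
    and excess_Gamma: "p \<in> Gamma_sonic S \<Longrightarrow> excess \<gamma> K (phi_minus S p) (gm p) = 0"
    and phi_match: "p \<in> Gamma_sonic S \<Longrightarrow> phi_plus S p = phi_minus S p"
    and g_match: "p \<in> Gamma_sonic S \<Longrightarrow> gp p = gm p"

lemma (in sonic_pair) sonic_pair_rot:
  "sonic_pair \<gamma> K (rotate_coords \<theta> S) (rot_vec \<theta> gm) (rot_op \<theta> Hm) (rot_vec \<theta> gp) (rot_op \<theta> Hp)"
proof (intro sonic_pair.intro sonic_pair_axioms.intro)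
  show "sonic_side (Omega_minus (rotate_coords \<theta> S)) (closure (Omega_minus (rotate_coords \<theta> S)))
     (phi_minus (rotate_coords \<theta> S)) (rot_vec \<theta> gm) (rot_op \<theta> Hm) \<gamma> K"
    using minus.sonic_side_rot[of \<theta>] by (simp add: closure_vimage_rot)
  show "sonic_side (Omega_plus (rotate_coords \<theta> S))
     (Omega_plus (rotate_coords \<theta> S) \<union> Gamma_sonic (rotate_coords \<theta> S))
     (phi_plus (rotate_coords \<theta> S)) (rot_vec \<theta> gp) (rot_op \<theta> Hp) \<gamma> K"
    using plus.sonic_side_rot[of \<theta>] by (simp add: vimage_Un)
qed (use gamma_gt_1 disjoint Gamma_closure excess_minus excess_plus excess_Gamma phi_match g_match
    in \<open>auto simp: rot_vec_def closure_vimage_rot\<close>)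

lemma sonic_configuration_imp_sonic_pair:
  assumes \<gamma>: "\<gamma> > 1" and conf: "sonic_configuration \<gamma> K S"
  obtains gm Hm gp Hp where "sonic_pair \<gamma> K S gm Hm gp Hp"
proof -
  let ?Am = "Omega_minus S" and ?Ap = "Omega_plus S" and ?G = "Gamma_sonic S"
  have op: "open ?Am" "open ?Ap" and disj: "?Am \<inter> ?Ap = {}"
    and C2: "C2_up_to ?Am (closure ?Am) (phi_minus S)" "C2_up_to ?Ap (?Ap \<union> ?G) (phi_plus S)"
    and flow: "potential_flow_on \<gamma> K ?Am (phi_minus S)" "potential_flow_on \<gamma> K ?Ap (phi_plus S)"
    and sup: "supersonic_on \<gamma> K ?Am (phi_minus S)" and sub: "subsonic_on \<gamma> K ?Ap (phi_plus S)"
    and G: "?G = curve_interior (sonic_points \<gamma> K ?Am (phi_minus S))"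
    and match: "\<And>p. p \<in> ?G \<Longrightarrow> phi_plus S p = phi_minus S p \<and>
        trace_from ?Ap (grad (phi_plus S)) p = trace_from ?Am (grad (phi_minus S)) p"
    using conf by (auto simp: sonic_configuration_def)
  obtain gm Hm where m: "c2_side ?Am (closure ?Am) (phi_minus S) gm Hm"
    using C2_up_to_imp_c2_side[OF C2(1) op(1)] by blast
  obtain gp Hp where p: "c2_side ?Ap (?Ap \<union> ?G) (phi_plus S) gp Hp"
    using C2_up_to_imp_c2_side[OF C2(2) op(2)] by blast
  interpret m: c2_side ?Am "closure ?Am" "phi_minus S" gm Hm by (rule m)
  interpret p: c2_side ?Ap "?Ap \<union> ?G" "phi_plus S" gp Hp by (rule p)
  have G_sonic: "?G \<subseteq> sonic_points \<gamma> K ?Am (phi_minus S)"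
    unfolding G curve_interior_def by blast
  have "sonic_pair \<gamma> K S gm Hm gp Hp"
  proof (intro sonic_pair.intro sonic_pair_axioms.intro sonic_side.intro sonic_side_axioms.intro m p \<gamma> disj)
    show cl: "?G \<subseteq> closure ?Am" using G_sonic by (auto simp: sonic_points_def)
  next
    fix q assume "q \<in> ?Am" "0 < sound_sq \<gamma> K (phi_minus S q) (gm q)"
    then show "sound_sq \<gamma> K (phi_minus S q) (gm q) * (trace_op (Hm q) + 2) = gm q \<bullet> gm q + gm q \<bullet> Hm q (gm q)"
      by (rule m.flow_eq_nondivergence[OF \<gamma> flow(1)])
  next
    fix q assume "q \<in> ?Ap" "0 < sound_sq \<gamma> K (phi_plus S q) (gp q)"
    then show "sound_sq \<gamma> K (phi_plus S q) (gp q) * (trace_op (Hp q) + 2) = gp q \<bullet> gp q + gp q \<bullet> Hp q (gp q)"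
      by (rule p.flow_eq_nondivergence[OF \<gamma> flow(2)])
  next
    fix q assume q: "q \<in> ?Am"
    then have "0 \<le> bernoulli K (phi_minus S q) (grad (phi_minus S) q)"
      using flow(1) unfolding potential_flow_on_def Let_def by blast
    then have "0 \<le> bernoulli K (phi_minus S q) (gm q)"
      by (simp add: m.grad_eq[OF q])
    then have "0 \<le> sound_sq \<gamma> K (phi_minus S q) (gm q)"
      using \<gamma> by (simp add: sound_sq_def bernoulli_def power2_norm_eq_inner)
    moreover have "sqrt (sound_sq \<gamma> K (phi_minus S q) (gm q)) < norm (gm q)"
      using sup[unfolded supersonic_on_def, rule_format, OF q] m.grad_eq[OF q]
      by (simp add: sonic_speed_eq)
    \<comment> \<open>The norm and the sonic speed are both square roots, so their comparison passes
      to the radicands.\<close>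
    ultimately show "excess \<gamma> K (phi_minus S q) (gm q) > 0"
      by (simp add: excess_def norm_eq_sqrt_inner)
  next
    fix q assume q: "q \<in> ?Ap"
    have "norm (gp q) < sqrt (sound_sq \<gamma> K (phi_plus S q) (gp q))"
      using sub[unfolded subsonic_on_def, rule_format, OF q] p.grad_eq[OF q]
      by (simp add: sonic_speed_eq)
    then show "excess \<gamma> K (phi_plus S q) (gp q) < 0"
      by (simp add: excess_def norm_eq_sqrt_inner)
  next
    fix q assume q: "q \<in> ?G"
    then have cl: "q \<in> closure ?Am" using G_sonic by (auto simp: sonic_points_def)
    have "norm (gm q) = sqrt (sound_sq \<gamma> K (phi_minus S q) (gm q))"
      using q G_sonic m.trace_grad[OF cl] by (auto simp: sonic_points_def sonic_speed_eq)
    then show "excess \<gamma> K (phi_minus S q) (gm q) = 0"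
      by (simp add: excess_def norm_eq_sqrt_inner)
    show "phi_plus S q = phi_minus S q" using match q by blast
    show "gp q = gm q" using match[OF q] m.trace_grad[OF cl] p.trace_grad[of q] q by simp
  qed
  then show thesis by (rule that)
qed

text \<open>A description of the sonic curve at \<open>Q\<close> that survives rotation, which being
  a graph need not: \<open>\<tau>\<close> is the velocity of a path in the curve, \<open>e\<close>
  directs a ray into the supersonic region, and the last clause says that \<open>\<tau>\<close> and
  \<open>e\<close> span the plane.\<close>

definition sonic_tangent :: "sonic_flow \<Rightarrow> real \<times> real \<Rightarrow> real \<times> real \<Rightarrow> real \<times> real \<Rightarrow> bool" where
  "sonic_tangent S Q \<tau> e \<longleftrightarrow>
     (\<exists>\<psi>. \<psi> 0 = Q \<and> (\<psi> has_derivative (\<lambda>t. t *\<^sub>R \<tau>)) (at 0) \<and> (\<forall>\<^sub>F t in at 0. \<psi> t \<in> Gamma_sonic S)) \<and>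
     (\<forall>\<^sub>F t in at_right 0. Q + t *\<^sub>R e \<in> Omega_minus S) \<and>
     (\<forall>v. v \<bullet> \<tau> = 0 \<and> v \<bullet> e = 0 \<longrightarrow> v = 0)"

lemma sonic_tangent_rot:
  assumes "sonic_tangent (rotate_coords \<theta> S) Q \<tau> e"
  shows "sonic_tangent S (rot \<theta> Q) (rot \<theta> \<tau>) (rot \<theta> e)"
proof -
  interpret linear "rot \<theta>" by (rule linear_rot)
  obtain \<psi> where \<psi>: "\<psi> 0 = Q" "(\<psi> has_derivative (\<lambda>t. t *\<^sub>R \<tau>)) (at 0)"
      "\<forall>\<^sub>F t in at 0. rot \<theta> (\<psi> t) \<in> Gamma_sonic S"
    and e: "\<forall>\<^sub>F t in at_right 0. rot \<theta> (Q + t *\<^sub>R e) \<in> Omega_minus S"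
    and indep: "\<And>v. v \<bullet> \<tau> = 0 \<Longrightarrow> v \<bullet> e = 0 \<Longrightarrow> v = 0"
    using assms by (auto simp: sonic_tangent_def)
  show ?thesis
    unfolding sonic_tangent_def
  proof (intro conjI allI impI)
    show "\<exists>\<psi>. \<psi> 0 = rot \<theta> Q \<and> (\<psi> has_derivative (\<lambda>t. t *\<^sub>R rot \<theta> \<tau>)) (at 0) \<and>
        (\<forall>\<^sub>F t in at 0. \<psi> t \<in> Gamma_sonic S)"
      using \<psi> has_derivative_compose[OF \<psi>(2) has_derivative_rot[of \<theta>]]
      by (intro exI[of _ "\<lambda>t. rot \<theta> (\<psi> t)"]) (simp add: scale)
    show "\<forall>\<^sub>F t in at_right 0. rot \<theta> Q + t *\<^sub>R rot \<theta> e \<in> Omega_minus S"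
      using e by (simp add: add scale)
  next
    fix v assume "v \<bullet> rot \<theta> \<tau> = 0 \<and> v \<bullet> rot \<theta> e = 0"
    then have "rot (- \<theta>) v = 0" by (intro indep) (simp_all add: inner_rot)
    then have "rot \<theta> (rot (- \<theta>) v) = rot \<theta> 0" by simp
    then show "v = 0" by (simp add: zero)
  qed
qed

text \<open>\<open>excess\<close> vanishes on the sonic curve and has a strict sign on each
  side.\<close>

lemma (in sonic_pair) Gamma_disjoint:
  "p \<in> Gamma_sonic S \<Longrightarrow> p \<notin> Omega_minus S \<and> p \<notin> Omega_plus S"
  using excess_minus[of p] excess_plus[of p] excess_Gamma[of p] phi_match[of p] g_match[of p] by auto

lemma (in c2_side) has_derivative_boundary:
  fixes f :: "real \<Rightarrow> real"
  assumes "r > 0" "L > 0" "\<sigma> = 1 \<or> \<sigma> = -1"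
    and "\<And>x y. \<lbrakk>\<bar>x - x0\<bar> < r; \<bar>y - x0\<bar> < r\<rbrakk> \<Longrightarrow> \<bar>f x - f y\<bar> \<le> L * \<bar>x - y\<bar>"
    and "Q = (x0, f x0)" "Q \<in> B"
    and "\<And>x y. \<lbrakk>(x, y) \<in> ball Q r; \<sigma> * y > \<sigma> * f x\<rbrakk> \<Longrightarrow> (x, y) \<in> A"
    and "\<And>x y. \<lbrakk>(x, y) \<in> ball Q r; (x, y) \<in> B\<rbrakk> \<Longrightarrow> \<sigma> * y \<ge> \<sigma> * f x"
  shows "(\<phi> has_derivative (\<lambda>v. g Q \<bullet> v)) (at Q within B)" "(g has_derivative H Q) (at Q within B)"
proof -
  have lim: "(h \<longlongrightarrow> h Q) (at Q within A)" if "continuous_on B h" for h :: "_ \<Rightarrow> 'z::topological_space"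
    using that assms(6) A_sub_B unfolding continuous_on_def by (blast intro: tendsto_within_subset)
  show "(\<phi> has_derivative (\<lambda>v. g Q \<bullet> v)) (at Q within B)"
  proof (rule has_derivative_at_graph_boundary[OF assms A_sub_B cont_\<phi> deriv_\<phi>])
    show "linear (\<lambda>v. g Q \<bullet> v)" by (rule bounded_linear.linear[OF bounded_linear_inner_right])
    show "((\<lambda>p. g p \<bullet> v) \<longlongrightarrow> g Q \<bullet> v) (at Q within A)" for v
      by (rule tendsto_inner[OF lim[OF cont_g] tendsto_const])
  qed
  show "(g has_derivative H Q) (at Q within B)"
    by (rule has_derivative_at_graph_boundary[OF assms A_sub_B cont_g deriv_g linear_H[OF assms(6)] lim[OF cont_H]])
qed

text \<open>In these coordinates the curve is a Lipschitz graph with the supersonic region above and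
  the subsonic one below, so the boundary derivatives come from \<sigma> = 1 and \<sigma> = -1. The
  tangent data are the slope vector of the graph and the upward vertical.\<close>

lemma (in sonic_pair) graph_near_consequences:
  assumes near: "sonic_graph_near S Q" and Q: "Q \<in> Gamma_sonic S"
  shows "(phi_minus S has_derivative (\<lambda>v. gm Q \<bullet> v)) (at Q within closure (Omega_minus S))"
    "(gm has_derivative Hm Q) (at Q within closure (Omega_minus S))"
    "(phi_plus S has_derivative (\<lambda>v. gp Q \<bullet> v)) (at Q within (Omega_plus S \<union> Gamma_sonic S))"
    "(gp has_derivative Hp Q) (at Q within (Omega_plus S \<union> Gamma_sonic S))"
    "\<exists>\<tau> e. sonic_tangent S Q \<tau> e"
proof -
  let ?Am = "Omega_minus S" and ?Ap = "Omega_plus S" and ?G = "Gamma_sonic S"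
  obtain r l1 l2 f where r: "0 < r" and f: "C11_on {l1<..<l2} f"
    and G: "?G \<inter> ball Q r = {(\<xi>, \<eta>). \<xi> \<in> {l1<..<l2} \<and> \<eta> = f \<xi>} \<inter> ball Q r"
    and Am: "{(\<xi>, \<eta>). \<xi> \<in> {l1<..<l2} \<and> \<eta> > f \<xi>} \<inter> ball Q r \<subseteq> ?Am"
    and Ap: "{(\<xi>, \<eta>). \<xi> \<in> {l1<..<l2} \<and> \<eta> < f \<xi>} \<inter> ball Q r \<subseteq> ?Ap"
    using near unfolding sonic_graph_near_def by blast
  have "Q \<in> ?G \<inter> ball Q r" using Q r by simp
  then obtain x0 where x0: "Q = (x0, f x0)" "l1 < x0" "x0 < l2"
    unfolding G by auto
  \<comment> \<open>With this radius every abscissa in the ball lies between \<open>l1\<close> and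
    \<open>l2\<close>, so only the position relative to the graph remains to be checked.\<close>
  define s where "s = min r (min (x0 - l1) (l2 - x0))"
  have I: "x \<in> {l1<..<l2}" if "\<bar>x - x0\<bar> < s" for x
    using that by (auto simp: s_def abs_if split: if_splits)
  have s: "s > 0" "s \<le> r" using r x0 by (auto simp: s_def)
  have fd: "(f has_real_derivative deriv f x) (at x)" if "x \<in> {l1<..<l2}" for x
    using f that by (auto simp: C11_on_def differentiable_on_eq_differentiable_at
        DERIV_deriv_iff_real_differentiable)
  obtain L0 where L0: "L0-lipschitz_on {l1<..<l2} (deriv f)"
    using f by (auto simp: C11_on_def)
  \<comment> \<open>A bound for the slope of \<open>f\<close> within distance \<open>s\<close> of
    \<open>x0\<close>, from the Lipschitz condition on \<open>deriv f\<close>; the summand 1 makes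
    it positive.\<close>
  define L where "L = \<bar>deriv f x0\<bar> + L0 * s + 1"
  have "L0 \<ge> 0" using L0 by (rule lipschitz_on_nonneg)
  then have L: "L > 0" using s by (simp add: L_def add_nonneg_pos)
  have bound: "\<bar>deriv f x\<bar> \<le> L" if "\<bar>x - x0\<bar> < s" for x
  proof -
    have "\<bar>deriv f x - deriv f x0\<bar> \<le> L0 * \<bar>x - x0\<bar>"
      using lipschitz_onD[OF L0, of x x0] I[OF that] x0 by (simp add: dist_real_def)
    also have "\<dots> \<le> L0 * s" using that \<open>L0 \<ge> 0\<close> by (intro mult_left_mono) auto
    finally show ?thesis by (simp add: L_def)
  qed
  have lip: "\<bar>f x - f y\<bar> \<le> L * \<bar>x - y\<bar>" if "\<bar>x - x0\<bar> < s" "\<bar>y - x0\<bar> < s" for x y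
  proof -
    have "norm (f x - f y) \<le> L * norm (x - y)"
    proof (rule field_differentiable_bound[of "ball x0 s"])
      fix z assume "z \<in> ball x0 s"
      then have z: "\<bar>z - x0\<bar> < s" by (simp add: dist_real_def abs_minus_commute)
      show "(f has_field_derivative deriv f z) (at z within ball x0 s)"
        using fd[OF I[OF z]] by (rule has_field_derivative_at_within)
      show "norm (deriv f z) \<le> L" using bound[OF z] by simp
    qed (use that in \<open>auto simp: dist_real_def abs_minus_commute\<close>)
    then show ?thesis by simp
  qed
  have ball: "x \<in> {l1<..<l2} \<and> (x, y) \<in> ball Q r" if "(x, y) \<in> ball Q s" for x y
  proof -
    have "\<bar>x - x0\<bar> < s"
      using that norm_fst_le[of "x - x0" "y - f x0"]
      by (simp add: x0(1) dist_commute[of "(x0, f x0)"]) (simp add: dist_norm)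
    then show ?thesis using I s that by auto
  qed
  have above: "(x, y) \<in> ?Am" if "(x, y) \<in> ball Q s" "1 * y > 1 * f x" for x y
    using ball[OF that(1)] that Am by auto
  have below: "(x, y) \<in> ?Ap" if "(x, y) \<in> ball Q s" "- 1 * y > - 1 * f x" for x y
    using ball[OF that(1)] that Ap by auto
  have disj: "closure ?Am \<inter> ?Ap = {}"
    using open_Int_closure_eq_empty[OF plus.open_A, of ?Am] disjoint by blast
  \<comment> \<open>Below the graph lies the open set \<open>Omega_plus S\<close>, which is disjoint
    from \<open>Omega_minus S\<close> and therefore misses its closure.\<close>
  have above_B: "1 * y \<ge> 1 * f x" if "(x, y) \<in> ball Q s" "(x, y) \<in> closure ?Am" for x y
  proof (rule ccontr)
    assume "\<not> 1 * y \<ge> 1 * f x"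
    then have "(x, y) \<in> ?Ap" by (intro below that(1)) simp
    then show False using that(2) disj by blast
  qed
  have below_B: "- 1 * y \<ge> - 1 * f x" if "(x, y) \<in> ball Q s" "(x, y) \<in> ?Ap \<union> ?G" for x y
  proof (rule ccontr)
    assume "\<not> - 1 * y \<ge> - 1 * f x"
    then have "(x, y) \<in> ?Am" by (intro above that(1)) simp
    then show False using that(2) disjoint Gamma_disjoint by blast
  qed
  have QB: "Q \<in> closure ?Am" "Q \<in> ?Ap \<union> ?G" using Q Gamma_closure by auto
  show "(phi_minus S has_derivative (\<lambda>v. gm Q \<bullet> v)) (at Q within closure ?Am)"
    "(gm has_derivative Hm Q) (at Q within closure ?Am)"
    by (rule minus.has_derivative_boundary[OF s(1) L _ lip x0(1) QB(1) above above_B]; simp)+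
  show "(phi_plus S has_derivative (\<lambda>v. gp Q \<bullet> v)) (at Q within (?Ap \<union> ?G))"
    "(gp has_derivative Hp Q) (at Q within (?Ap \<union> ?G))"
    by (rule plus.has_derivative_boundary[OF s(1) L _ lip x0(1) QB(2) below below_B]; simp)+
  have "sonic_tangent S Q (1, deriv f x0) (0, 1)"
    unfolding sonic_tangent_def
  proof (intro conjI exI[of _ "\<lambda>t. (x0 + t, f (x0 + t))"] allI impI)
    show "(x0 + 0, f (x0 + 0)) = Q" by (simp add: x0)
    have "(f has_derivative (\<lambda>t. deriv f x0 * t)) (at (x0 + 0))"
      using fd[of x0] x0 by (simp add: has_field_derivative_def)
    then have "((\<lambda>t. f (x0 + t)) has_derivative (\<lambda>t. deriv f x0 * t)) (at 0)"
      using has_derivative_compose[of "\<lambda>t. x0 + t" "\<lambda>t. t" 0 UNIV f "\<lambda>t. deriv f x0 * t"]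
      by (simp add: has_derivative_const has_derivative_add[of "\<lambda>_. x0" "\<lambda>_. 0" _ "\<lambda>t. t" "\<lambda>t. t", simplified])
    then have "((\<lambda>t. (x0 + t, f (x0 + t))) has_derivative (\<lambda>t. (t, deriv f x0 * t))) (at 0)"
      by (intro has_derivative_Pair) (simp_all add: has_derivative_add[of "\<lambda>_. x0" "\<lambda>_. 0" _ "\<lambda>t. t" "\<lambda>t. t", simplified])
    then show D: "((\<lambda>t. (x0 + t, f (x0 + t))) has_derivative (\<lambda>t. t *\<^sub>R (1, deriv f x0))) (at 0)"
      by (simp add: mult.commute)
    have "((\<lambda>t. (x0 + t, f (x0 + t))) \<longlongrightarrow> Q) (at 0)"
      using has_derivative_continuous[OF D] by (simp add: continuous_within x0)
    then have "\<forall>\<^sub>F t in at 0. dist (x0 + t, f (x0 + t)) Q < s" using s(1) by (rule tendstoD)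
    then show "\<forall>\<^sub>F t in at 0. (x0 + t, f (x0 + t)) \<in> ?G"
    proof eventually_elim
      case (elim t)
      then have "(x0 + t, f (x0 + t)) \<in> ball Q s" by (simp add: dist_commute)
      from ball[OF this] have "(x0 + t, f (x0 + t)) \<in> ?G \<inter> ball Q r" unfolding G by simp
      then show ?case by blast
    qed
    show "\<forall>\<^sub>F t in at_right 0. Q + t *\<^sub>R (0, 1) \<in> ?Am"
      unfolding eventually_at_right_field
    proof (intro exI[of _ s] conjI allI impI)
      fix t :: real assume t: "0 < t" "t < s"
      then have "(x0, f x0 + t) \<in> ball Q s" by (simp add: x0(1) dist_Pair_Pair dist_real_def)
      then show "Q + t *\<^sub>R (0, 1) \<in> ?Am" using above[of x0 "f x0 + t"] t by (simp add: x0(1))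
    qed (rule s)
    fix v :: "real \<times> real" assume "v \<bullet> (1, deriv f x0) = 0 \<and> v \<bullet> (0, 1) = 0"
    then show "v = 0" by (cases v) (auto simp: zero_prod_def)
  qed
  then show "\<exists>\<tau> e. sonic_tangent S Q \<tau> e" by blast
qed

locale sonic_pair_at = sonic_pair \<gamma> K S gm Hm gp Hp for \<gamma> K S gm Hm gp Hp +
  fixes Q \<tau> e :: "real \<times> real"
  assumes Q_Gamma: "Q \<in> Gamma_sonic S"
    and Dphi_minus: "(phi_minus S has_derivative (\<lambda>v. gm Q \<bullet> v)) (at Q within closure (Omega_minus S))"
    and Dgm: "(gm has_derivative Hm Q) (at Q within closure (Omega_minus S))"
    and Dphi_plus: "(phi_plus S has_derivative (\<lambda>v. gp Q \<bullet> v)) (at Q within (Omega_plus S \<union> Gamma_sonic S))"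
    and Dgp: "(gp has_derivative Hp Q) (at Q within (Omega_plus S \<union> Gamma_sonic S))"
    and tangent: "sonic_tangent S Q \<tau> e"

lemma rot_vec_rot: "rot_vec b (rot_vec a g) = rot_vec (a + b) g"
  by (simp add: rot_vec_def rot_rot add.commute)

lemma rot_op_rot: "rot_op b (rot_op a g) = rot_op (a + b) g"
  by (simp add: rot_op_def rot_rot add.commute)

lemma rotate_coords_0 [simp]: "rotate_coords 0 S = S"
  by (simp add: rotate_coords_def vimage_def comp_def)

lemma (in sonic_pair_at) sonic_pair_at_rot:
  "sonic_pair_at \<gamma> K (rotate_coords \<theta> S) (rot_vec \<theta> gm) (rot_op \<theta> Hm) (rot_vec \<theta> gp) (rot_op \<theta> Hp)
    (rot (- \<theta>) Q) (rot (- \<theta>) \<tau>) (rot (- \<theta>) e)"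
proof (intro sonic_pair_at.intro sonic_pair_at_axioms.intro sonic_pair_rot)
  have Q': "rot \<theta> (rot (- \<theta>) Q) = Q" by simp
  have vec: "(rot_vec \<theta> g has_derivative rot_op \<theta> H (rot (- \<theta>) Q)) (at (rot (- \<theta>) Q) within rot \<theta> -` B)"
    if "(g has_derivative H Q) (at Q within B)" for g H B
  proof -
    have "((\<lambda>q. g (rot \<theta> q)) has_derivative (\<lambda>v. H Q (rot \<theta> v))) (at (rot (- \<theta>) Q) within rot \<theta> -` B)"
      using has_derivative_comp_rot[of g "H Q" \<theta> "rot (- \<theta>) Q" B] that by simp
    from has_derivative_compose[OF this has_derivative_rot[of "- \<theta>"]] show ?thesis
      by (simp add: rot_vec_def rot_op_def)
  qed
  have scal: "(\<phi> \<circ> rot \<theta> has_derivative (\<lambda>v. rot_vec \<theta> g (rot (- \<theta>) Q) \<bullet> v)) (at (rot (- \<theta>) Q) within rot \<theta> -` B)"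
    if "(\<phi> has_derivative (\<lambda>v. g Q \<bullet> v)) (at Q within B)" for \<phi> g B
    using has_derivative_comp_rot[of \<phi> "\<lambda>v. g Q \<bullet> v" \<theta> "rot (- \<theta>) Q" B] that
    by (simp add: comp_def rot_vec_def inner_rot)
  show "rot (- \<theta>) Q \<in> Gamma_sonic (rotate_coords \<theta> S)" using Q_Gamma by simp
  show "(phi_minus (rotate_coords \<theta> S) has_derivative (\<lambda>v. rot_vec \<theta> gm (rot (- \<theta>) Q) \<bullet> v))
     (at (rot (- \<theta>) Q) within closure (Omega_minus (rotate_coords \<theta> S)))"
    using scal[of "phi_minus S" gm, OF Dphi_minus] by (simp add: closure_vimage_rot)
  show "(rot_vec \<theta> gm has_derivative rot_op \<theta> Hm (rot (- \<theta>) Q))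
     (at (rot (- \<theta>) Q) within closure (Omega_minus (rotate_coords \<theta> S)))"
    using vec[of gm Hm, OF Dgm] by (simp add: closure_vimage_rot)
  show "(phi_plus (rotate_coords \<theta> S) has_derivative (\<lambda>v. rot_vec \<theta> gp (rot (- \<theta>) Q) \<bullet> v))
     (at (rot (- \<theta>) Q) within (Omega_plus (rotate_coords \<theta> S) \<union> Gamma_sonic (rotate_coords \<theta> S)))"
    using scal[of "phi_plus S" gp, OF Dphi_plus] by (simp add: vimage_Un)
  show "(rot_vec \<theta> gp has_derivative rot_op \<theta> Hp (rot (- \<theta>) Q))
     (at (rot (- \<theta>) Q) within (Omega_plus (rotate_coords \<theta> S) \<union> Gamma_sonic (rotate_coords \<theta> S)))"
    using vec[of gp Hp, OF Dgp] by (simp add: vimage_Un)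
  show "sonic_tangent (rotate_coords \<theta> S) (rot (- \<theta>) Q) (rot (- \<theta>) \<tau>) (rot (- \<theta>) e)"
    by (rule sonic_tangent_rot) (simp add: rotate_coords_add tangent)
qed

text \<open>The regularity at \<open>Q\<close> is proved in the coordinates in which the sonic curve is a graph and
  then carried over to the coordinates in which the streamline is one.\<close>

lemma sonic_configuration_imp_sonic_pair_at:
  assumes \<gamma>: "\<gamma> > 1" and conf: "sonic_configuration \<gamma> K S"
    and Q: "Q \<in> Gamma_sonic (rotate_coords \<theta> S)"
  obtains gm Hm gp Hp \<tau> e where "sonic_pair_at \<gamma> K (rotate_coords \<theta> S) gm Hm gp Hp Q \<tau> e"
proof -
  obtain gm Hm gp Hp where "sonic_pair \<gamma> K S gm Hm gp Hp"
    using sonic_configuration_imp_sonic_pair[OF \<gamma> conf] by blast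
  then interpret sonic_pair \<gamma> K S gm Hm gp Hp .
  have QS: "rot \<theta> Q \<in> Gamma_sonic S" using Q by simp
  then obtain \<alpha> where near: "sonic_graph_near (rotate_coords \<alpha> S) (rot (- \<alpha>) (rot \<theta> Q))"
    using conf unfolding sonic_configuration_def by blast
  interpret rotated: sonic_pair \<gamma> K "rotate_coords \<alpha> S" "rot_vec \<alpha> gm" "rot_op \<alpha> Hm"
    "rot_vec \<alpha> gp" "rot_op \<alpha> Hp"
    by (rule sonic_pair_rot)
  have Q\<alpha>: "rot (- \<alpha>) (rot \<theta> Q) \<in> Gamma_sonic (rotate_coords \<alpha> S)" using QS by simp
  obtain \<tau> e where "sonic_tangent (rotate_coords \<alpha> S) (rot (- \<alpha>) (rot \<theta> Q)) \<tau> e"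
    using rotated.graph_near_consequences(5)[OF near Q\<alpha>] by blast
  then interpret at: sonic_pair_at \<gamma> K "rotate_coords \<alpha> S" "rot_vec \<alpha> gm" "rot_op \<alpha> Hm"
    "rot_vec \<alpha> gp" "rot_op \<alpha> Hp" "rot (- \<alpha>) (rot \<theta> Q)" \<tau> e
    by unfold_locales (use Q\<alpha> rotated.graph_near_consequences(1-4)[OF near Q\<alpha>] in auto)
  show thesis
  proof (rule that)
    show "sonic_pair_at \<gamma> K (rotate_coords \<theta> S) (rot_vec \<theta> gm) (rot_op \<theta> Hm)
        (rot_vec \<theta> gp) (rot_op \<theta> Hp) Q (rot (\<alpha> - \<theta>) \<tau>) (rot (\<alpha> - \<theta>) e)"
      \<comment> \<open>The sonic curve is a graph at angle \<open>\<alpha>\<close>, the streamline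
        at angle \<open>\<theta>\<close>; the difference turns the first frame into the
        second.\<close>
      using at.sonic_pair_at_rot[of "\<theta> - \<alpha>"]
      by (simp add: rotate_coords_add rot_vec_rot rot_op_rot rot_rot)
  qed
qed

section \<open>One-sided limits of the flow equation\<close>

text \<open>The velocity turned clockwise by a right angle, so that differentiation along it is the
  operator \<open>\<partial>\<^sup>\<bottom>\<close>.\<close>

definition perp :: "real \<times> real \<Rightarrow> real \<times> real" where
  "perp w = (snd w, - fst w)"

lemma (in c2_side) at_within_A_neq_bot: "p \<in> B \<Longrightarrow> at p within A \<noteq> bot"
  using not_trivial_limit_closure_open[OF open_A] B_sub_closure by blast

lemma (in c2_side) tendsto_from_A:
  fixes h :: "real \<times> real \<Rightarrow> 'z::topological_space"
  assumes "continuous_on B h" "p \<in> B"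
  shows "(h \<longlongrightarrow> h p) (at p within A)"
  using assms A_sub_B unfolding continuous_on_def by (blast intro: tendsto_within_subset)

lemma (in c2_side) cont_sound_sq: "continuous_on B (\<lambda>q. sound_sq \<gamma> K (\<phi> q) (g q))"
  unfolding sound_sq_def by (intro continuous_intros cont_\<phi> cont_g) simp_all

lemma (in c2_side) eventually_sound_sq_pos:
  assumes "p \<in> B" "sound_sq \<gamma> K (\<phi> p) (g p) > 0"
  shows "\<forall>\<^sub>F q in at p within A. q \<in> A \<and> sound_sq \<gamma> K (\<phi> q) (g q) > 0"
  using order_tendstoD(1)[OF tendsto_from_A[OF cont_sound_sq assms(1)] assms(2)]
  by (simp add: eventually_conj_iff eventually_at_filter)

lemma (in c2_side) cont_inner_H: "continuous_on B (\<lambda>q. g q \<bullet> H q v)"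
  by (intro continuous_intros cont_g cont_H)

lemma (in c2_side) cont_inner_H_g: "continuous_on B (\<lambda>q. g q \<bullet> H q (g q))"
proof -
  have "continuous_on B (\<lambda>q. fst (g q) * (g q \<bullet> H q (1, 0)) + snd (g q) * (g q \<bullet> H q (0, 1)))"
    by (intro continuous_intros cont_g cont_inner_H)
  moreover have "g q \<bullet> H q (g q) = fst (g q) * (g q \<bullet> H q (1, 0)) + snd (g q) * (g q \<bullet> H q (0, 1))"
    if "q \<in> B" for q
    by (subst H_components[OF that, of "g q"]) (simp add: inner_add_right)
  ultimately show ?thesis by (simp cong: continuous_on_cong)
qed

text \<open>Both sides are continuous on \<open>B\<close> and c^2 stays positive near
  \<open>p\<close>, so the equation survives the limit from \<open>A\<close>.\<close>

lemma (in sonic_side) flow_eq_boundary: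
  assumes p: "p \<in> B" and pos: "sound_sq \<gamma> K (\<phi> p) (g p) > 0"
  shows "sound_sq \<gamma> K (\<phi> p) (g p) * (trace_op (H p) + 2) = g p \<bullet> g p + g p \<bullet> H p (g p)"
proof (rule tendsto_unique[OF at_within_A_neq_bot[OF p]])
  show "((\<lambda>q. sound_sq \<gamma> K (\<phi> q) (g q) * (trace_op (H q) + 2)) \<longlongrightarrow>
      sound_sq \<gamma> K (\<phi> p) (g p) * (trace_op (H p) + 2)) (at p within A)"
    by (rule tendsto_from_A[OF _ p]) (intro continuous_intros cont_sound_sq cont_H)
  have "((\<lambda>q. g q \<bullet> g q + g q \<bullet> H q (g q)) \<longlongrightarrow> g p \<bullet> g p + g p \<bullet> H p (g p)) (at p within A)"
    by (rule tendsto_from_A[OF _ p]) (intro continuous_intros cont_g cont_inner_H_g)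
  then show "((\<lambda>q. sound_sq \<gamma> K (\<phi> q) (g q) * (trace_op (H q) + 2)) \<longlongrightarrow>
      g p \<bullet> g p + g p \<bullet> H p (g p)) (at p within A)"
    by (rule Lim_transform_eventually)
       (use eventually_sound_sq_pos[OF p pos] in \<open>auto elim!: eventually_mono simp: flow_eq\<close>)
qed

text \<open>For w = \<open>g p\<close>, the vectors w and \<open>perp w\<close> are orthogonal and
  equally long, so |w|^2 times the trace is H[w, w] + H[perp w, perp w]. At c^2 = |w|^2 the term
  H[w, w] cancels from the flow equation.\<close>

lemma (in sonic_side) flow_eq_sonic:
  assumes p: "p \<in> B" and sonic: "sound_sq \<gamma> K (\<phi> p) (g p) = g p \<bullet> g p" and nz: "g p \<noteq> 0"
  shows "perp (g p) \<bullet> H p (perp (g p)) = - (g p \<bullet> g p)"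
proof -
  obtain U V where UV: "g p = (U, V)" by (cases "g p")
  have "g p \<bullet> g p * (trace_op (H p) + 2) = g p \<bullet> g p + g p \<bullet> H p (g p)"
    using flow_eq_boundary[OF p] sonic nz by simp
  then show ?thesis
    unfolding UV perp_def H_components[OF p, of "(U, V)"] H_components[OF p, of "(snd (U, V), - fst (U, V))"]
    by (simp add: inner_prod_def algebra_simps)
qed

text \<open>The gradient of c is - (\<gamma> - 1) (w + H w) / (2 c) with w = \<open>g p\<close>;
  paired with \<open>perp w\<close>, the summand w drops out by orthogonality.\<close>

lemma (in c2_side) perp_deriv_c_eq:
  assumes p: "p \<in> B" and pos: "sound_sq \<gamma> K (\<phi> p) (g p) > 0"
  shows "perp_deriv_c \<gamma> K A \<phi> p
    = - (\<gamma> - 1) / (2 * sqrt (sound_sq \<gamma> K (\<phi> p) (g p))) * (g p \<bullet> H p (perp (g p)))"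
proof -
  let ?s = "\<lambda>q. sound_sq \<gamma> K (\<phi> q) (g q)"
  let ?c = "\<lambda>q. sonic_speed \<gamma> K (\<phi> q) (grad \<phi> q)"
  define C where "C = (\<lambda>v q. - (\<gamma> - 1) * (g q \<bullet> v + g q \<bullet> H q v) / (2 * sqrt (?s q)))"
  have deriv: "(?c has_derivative (\<lambda>v. C v q)) (at q)" if q: "q \<in> A" "?s q > 0" for q
  proof (rule has_derivative_transform_within_open[OF _ open_A q(1)])
    show "((\<lambda>q. sqrt (?s q)) has_derivative (\<lambda>v. C v q)) (at q)"
      using has_derivative_real_sqrt[OF q(2) deriv_sound_sq[OF q(1)]]
      by (simp add: C_def field_simps)
  qed (simp add: sonic_speed_eq grad_eq)
  have lim: "(C v \<longlongrightarrow> C v p) (at p within A)" for v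
    unfolding C_def
    by (intro tendsto_intros tendsto_from_A[OF cont_sound_sq p] tendsto_from_A[OF cont_g p]
        tendsto_from_A[OF cont_H p]) (use pos in simp)
  have ev: "\<forall>\<^sub>F q in at p within A. C (1, 0) q = d_xi ?c q \<and> C (0, 1) q = d_eta ?c q"
    using eventually_sound_sq_pos[OF p pos]
    by eventually_elim (use partials_of_has_derivative[OF deriv] in auto)
  have cl: "p \<in> closure A" using p B_sub_closure by auto
  have x: "trace_from A (d_xi ?c) p = C (1, 0) p"
    by (rule trace_from_eqI[OF Lim_transform_eventually[OF lim] open_A cl])
       (use ev in \<open>auto elim: eventually_mono\<close>)
  have y: "trace_from A (d_eta ?c) p = C (0, 1) p"
    by (rule trace_from_eqI[OF Lim_transform_eventually[OF lim] open_A cl])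
       (use ev in \<open>auto elim: eventually_mono\<close>)
  obtain U V where UV: "g p = (U, V)" by (cases "g p")
  have "perp_deriv_c \<gamma> K A \<phi> p = V * C (1, 0) p - U * C (0, 1) p"
    unfolding perp_deriv_c_def Let_def x y trace_d_xi[OF p] trace_d_eta[OF p] UV by simp
  also have "\<dots> = - (\<gamma> - 1) / (2 * sqrt (?s p)) * (g p \<bullet> H p (perp (g p)))"
    unfolding H_components[OF p, of "perp (g p)"] C_def
    using pos by (simp add: UV perp_def inner_diff_right inner_add_right field_simps)
  finally show ?thesis .
qed

section \<open>First-order information along the sonic curve and along rays\<close>

lemma tangential_derivative_eq:
  assumes tan: "sonic_tangent S Q \<tau> e"
    and u: "(u has_derivative D) (at Q within Gamma_sonic S)"
    and v: "(v has_derivative E) (at Q within Gamma_sonic S)"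
    and eq: "\<And>p. p \<in> Gamma_sonic S \<Longrightarrow> u p = v p" and Q: "Q \<in> Gamma_sonic S"
  shows "D \<tau> = E \<tau>"
proof -
  obtain \<psi> where \<psi>: "\<psi> 0 = Q" "(\<psi> has_derivative (\<lambda>t. t *\<^sub>R \<tau>)) (at (0::real))"
      "\<forall>\<^sub>F t in at 0. \<psi> t \<in> Gamma_sonic S"
    using tan by (auto simp: sonic_tangent_def)
  \<comment> \<open>The parameters that \<open>\<psi>\<close> sends into the curve form a
    neighbourhood of 0, so derivatives within this set are ordinary ones, hence unique.\<close>
  let ?X = "\<psi> -` Gamma_sonic S"
  have "\<forall>\<^sub>F t in nhds 0. t \<in> ?X"
    using \<psi>(1,3) Q by (simp add: eventually_nhds_conv_at)
  then have X: "at 0 within ?X = at 0"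
    by (intro at_within_interior) (simp add: eventually_nhds_in_nhd eventually_nhds interior_def, blast)
  have comp: "((\<lambda>t. w (\<psi> t)) has_derivative (\<lambda>t. T (t *\<^sub>R \<tau>))) (at 0)"
    if "(w has_derivative T) (at Q within Gamma_sonic S)" for w :: "real \<times> real \<Rightarrow> 'a" and T
  proof -
    have "(w has_derivative T) (at (\<psi> 0) within \<psi> ` ?X)"
      unfolding \<psi>(1) by (rule has_derivative_subset[OF that]) auto
    from has_derivative_in_compose[OF has_derivative_at_withinI[OF \<psi>(2)] this] show ?thesis
      unfolding X .
  qed
  have "((\<lambda>t. u (\<psi> t)) has_derivative (\<lambda>t. E (t *\<^sub>R \<tau>))) (at 0 within ?X)"
    by (rule has_derivative_transform[OF _ _ has_derivative_at_withinI[OF comp[OF v]]])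
       (use \<psi>(1) Q eq in auto)
  then have "((\<lambda>t. u (\<psi> t)) has_derivative (\<lambda>t. E (t *\<^sub>R \<tau>))) (at 0)" unfolding X .
  with comp[OF u] have "(\<lambda>t. D (t *\<^sub>R \<tau>)) = (\<lambda>t. E (t *\<^sub>R \<tau>))" by (rule has_derivative_unique)
  from fun_cong[OF this, of 1] show ?thesis by simp
qed

lemma one_sided_directional_derivative_nonneg:
  fixes u :: "'a::real_normed_vector \<Rightarrow> real"
  assumes u: "(u has_derivative D) (at Q within B)"
    and ev: "\<forall>\<^sub>F t in at_right 0. Q + t *\<^sub>R e \<in> B \<and> u (Q + t *\<^sub>R e) \<ge> u Q"
  shows "D e \<ge> 0"
proof -
  obtain b :: real where b: "b > 0"
    and in_B: "\<And>t. 0 < t \<Longrightarrow> t < b \<Longrightarrow> Q + t *\<^sub>R e \<in> B \<and> u (Q + t *\<^sub>R e) \<ge> u Q"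
    using ev unfolding eventually_at_right_field by blast
  let ?l = "\<lambda>t. Q + t *\<^sub>R e"
  interpret bounded_linear D by (rule has_derivative_bounded_linear[OF u])
  have "(?l has_derivative (\<lambda>t. t *\<^sub>R e)) (at 0 within {0<..<b})"
    by (auto intro!: derivative_eq_intros)
  moreover have "(u has_derivative D) (at (?l 0) within ?l ` {0<..<b})"
    by (rule has_derivative_subset) (use u in_B in auto)
  ultimately have "((\<lambda>t. u (?l t)) has_derivative (\<lambda>t. D (t *\<^sub>R e))) (at 0 within {0<..<b})"
    by (rule has_derivative_in_compose)
  then have "((\<lambda>t. u (?l t)) has_real_derivative D e) (at 0 within {0<..<b})"
    by (simp add: has_field_derivative_def scaleR mult_commute_abs)
  then have "((\<lambda>t. (u (?l t) - u Q) / t) \<longlongrightarrow> D e) (at 0 within {0<..<b})"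
    by (simp add: has_field_derivative_iff)
  moreover have "at 0 within {0<..<b} = at_right (0::real)"
    using b by (intro at_within_nhd[of _ "{..<b}"]) auto
  ultimately have lim: "((\<lambda>t. (u (?l t) - u Q) / t) \<longlongrightarrow> D e) (at_right 0)" by simp
  have "\<forall>\<^sub>F t in at_right 0. 0 \<le> (u (?l t) - u Q) / t"
    unfolding eventually_at_right_field by (intro exI[of _ b]) (use b in_B in auto)
  then show ?thesis by (rule tendsto_lowerbound[OF lim]) simp
qed

text \<open>Let M be the symmetric matrix with kernel vector t. Then M n is orthogonal to t, and to
  n by the last hypothesis. If the determinant \<open>?d\<close> of t and n is nonzero, this forces
  M n = 0; otherwise n is a multiple of t.\<close>

lemma singular_quadratic_form_zero:
  fixes a b c n1 n2 t1 t2 :: real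
  assumes "a * t1 + b * t2 = 0" "b * t1 + c * t2 = 0" "t1 \<noteq> 0 \<or> t2 \<noteq> 0"
    and "n1 * (a * n1 + b * n2) + n2 * (b * n1 + c * n2) = 0"
  shows "a * n1 + b * n2 = 0" "b * n1 + c * n2 = 0"
proof -
  let ?y = "a * n1 + b * n2" and ?z = "b * n1 + c * n2" and ?d = "t1 * n2 - t2 * n1"
  have "?y * ?d = 0" "?z * ?d = 0" using assms(1,2,4) by algebra+
  moreover have "?y * t1 = 0 \<and> ?y * t2 = 0 \<and> ?z * t1 = 0 \<and> ?z * t2 = 0" if "?d = 0"
    using assms(1,2) that by algebra
  ultimately show "?y = 0" "?z = 0" using assms(3) by (metis mult_eq_0_iff)+
qed

lemma has_derivative_within_Un:
  assumes "(f has_derivative D) (at x within A)" "(f has_derivative D) (at x within B)"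
  shows "(f has_derivative D) (at x within (A \<union> B))"
  using assms unfolding has_derivative_within by (auto intro: Lim_Un)

section \<open>Curvature of the streamline\<close>

lemma (in c2_side) symmetric_entries:
  assumes "p \<in> B"
  obtains a b c where "\<And>v. H p v = (a * fst v + b * snd v, b * fst v + c * snd v)"
proof -
  have "snd (H p (1, 0)) = fst (H p (0, 1))"
    using symmetric_H[OF assms, of "(1, 0)" "(0, 1)"] by (simp add: inner_prod_def)
  then show thesis
    by (intro that[of "fst (H p (1, 0))" "snd (H p (1, 0))" "snd (H p (0, 1))"])
       (subst H_components[OF assms], auto simp: prod_eq_iff algebra_simps)
qed

text \<open>The coefficient \<open>\<gamma> + 1\<close> collects 2 from |D\<phi>|^2 and
  \<open>\<gamma> - 1\<close> from c^2.\<close>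

lemma has_derivative_excess:
  assumes "(\<phi> has_derivative (\<lambda>v. g Q \<bullet> v)) (at Q within B)" "(g has_derivative T) (at Q within B)"
  shows "((\<lambda>p. excess \<gamma> K (\<phi> p) (g p)) has_derivative
    (\<lambda>v. (\<gamma> + 1) * (g Q \<bullet> T v) + (\<gamma> - 1) * (g Q \<bullet> v))) (at Q within B)"
  unfolding excess_def sound_sq_def
  by (rule derivative_eq_intros assms refl)+ (auto simp: algebra_simps inner_commute)

context sonic_pair_at begin

abbreviation "W \<equiv> gm Q"

abbreviation "flow_region \<equiv> closure (Omega_minus S) \<union> (Omega_plus S \<union> Gamma_sonic S)"

lemma Q_closure: "Q \<in> closure (Omega_minus S)" and Q_plus: "Q \<in> Omega_plus S \<union> Gamma_sonic S"
  using Q_Gamma Gamma_closure by auto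

lemma gp_Q: "gp Q = W" and phi_Q: "phi_plus S Q = phi_minus S Q"
  using g_match phi_match Q_Gamma by auto

lemma sound_sq_Q: "sound_sq \<gamma> K (phi_minus S Q) W = W \<bullet> W"
  using excess_Gamma[OF Q_Gamma] by (simp add: excess_def)

text \<open>If \<open>\<tau>\<close> vanished, \<open>perp e\<close> would be orthogonal to both
  vectors, so \<open>e\<close> would vanish too, and then every vector would be orthogonal to
  both.\<close>

lemma tau_neq_0: "\<tau> \<noteq> 0"
proof
  assume \<tau>: "\<tau> = 0"
  have indep: "\<And>v. v \<bullet> \<tau> = 0 \<Longrightarrow> v \<bullet> e = 0 \<Longrightarrow> v = 0"
    using tangent by (auto simp: sonic_tangent_def)
  have "perp e = 0" by (rule indep) (simp_all add: \<tau> perp_def inner_prod_def)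
  then have "e = 0" by (simp add: perp_def prod_eq_iff)
  then have "(1, 0) = (0 :: real \<times> real)" by (intro indep) (simp_all add: \<tau>)
  then show False by (simp add: zero_prod_def)
qed

lemma closure_disjoint_plus: "closure (Omega_minus S) \<inter> Omega_plus S = {}"
  using open_Int_closure_eq_empty[OF plus.open_A, of "Omega_minus S"] disjoint by blast

text \<open>The gradients from the two sides coincide along the sonic curve, hence so do their
  derivatives in its direction.\<close>

lemma hessians_agree_tangentially: "Hm Q \<tau> = Hp Q \<tau>"
proof (rule tangential_derivative_eq[OF tangent _ _ _ Q_Gamma])
  show "(gm has_derivative Hm Q) (at Q within Gamma_sonic S)"
    by (rule has_derivative_subset[OF Dgm Gamma_closure])
  show "(gp has_derivative Hp Q) (at Q within Gamma_sonic S)"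
    by (rule has_derivative_subset[OF Dgp]) auto
qed (simp add: g_match)

text \<open>\<open>excess\<close> is identically zero along the sonic curve.\<close>

lemma excess_tangential: "(\<gamma> + 1) * (W \<bullet> Hm Q \<tau>) + (\<gamma> - 1) * (W \<bullet> \<tau>) = 0"
proof -
  have "((\<lambda>p. excess \<gamma> K (phi_minus S p) (gm p)) has_derivative
    (\<lambda>v. (\<gamma> + 1) * (W \<bullet> Hm Q v) + (\<gamma> - 1) * (W \<bullet> v))) (at Q within Gamma_sonic S)"
    by (rule has_derivative_subset[OF has_derivative_excess[OF Dphi_minus Dgm] Gamma_closure])
  from tangential_derivative_eq[OF tangent this has_derivative_const[of 0] _ Q_Gamma]
  show ?thesis by (simp add: excess_Gamma)
qed

text \<open>The Hessians from the two sides differ by a multiple of \<open>n n\<^sup>T\<close>, \<open>n\<close> normal to the sonic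
  curve, and by the flow equation this difference is isotropic in the direction \<open>perp W\<close>.\<close>

lemma perp_hessians_agree:
  assumes nz: "W \<noteq> 0"
  shows "perp W \<bullet> Hp Q v = perp W \<bullet> Hm Q v"
proof -
  obtain a b c where m: "\<And>v. Hm Q v = (a * fst v + b * snd v, b * fst v + c * snd v)"
    using minus.symmetric_entries[OF Q_closure] by metis
  obtain a' b' c' where p: "\<And>v. Hp Q v = (a' * fst v + b' * snd v, b' * fst v + c' * snd v)"
    using plus.symmetric_entries[OF Q_plus] by metis
  obtain n1 n2 where n: "perp W = (n1, n2)" by (cases "perp W")
  obtain t1 t2 where t: "\<tau> = (t1, t2)" by (cases \<tau>)
  have "perp W \<bullet> Hm Q (perp W) = - (W \<bullet> W)" "perp W \<bullet> Hp Q (perp W) = - (W \<bullet> W)"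
    using minus.flow_eq_sonic[OF Q_closure] plus.flow_eq_sonic[OF Q_plus] nz
    by (simp_all add: sound_sq_Q gp_Q phi_Q)
  then have "perp W \<bullet> Hp Q (perp W) = perp W \<bullet> Hm Q (perp W)" by simp
  then have "n1 * ((a' - a) * n1 + (b' - b) * n2) + n2 * ((b' - b) * n1 + (c' - c) * n2) = 0"
    by (simp add: n m p inner_prod_def algebra_simps)
  moreover have "(a' - a) * t1 + (b' - b) * t2 = 0" "(b' - b) * t1 + (c' - c) * t2 = 0"
    using hessians_agree_tangentially by (simp_all add: m p t algebra_simps)
  moreover have "t1 \<noteq> 0 \<or> t2 \<noteq> 0" using tau_neq_0 by (auto simp: t zero_prod_def)
  ultimately have "(a' - a) * n1 + (b' - b) * n2 = 0" "(b' - b) * n1 + (c' - c) * n2 = 0"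
    using singular_quadratic_form_zero[of "a' - a" t1 "b' - b" t2 "c' - c" n1 n2] by auto
  then have "n1 * (a' * fst v + b' * snd v) + n2 * (b' * fst v + c' * snd v)
      = n1 * (a * fst v + b * snd v) + n2 * (b * fst v + c * snd v)"
    by algebra
  then show ?thesis by (simp add: n m p inner_prod_def)
qed

section \<open>The one-sided derivatives of the sonic speed and the velocity across the
  curve\<close>

lemma perp_deriv_c_minus:
  assumes "W \<noteq> 0"
  shows "perp_deriv_c \<gamma> K (Omega_minus S) (phi_minus S) Q
    = - (\<gamma> - 1) / (2 * norm W) * (perp W \<bullet> Hm Q W)"
  using minus.perp_deriv_c_eq[OF Q_closure, of \<gamma> K] minus.symmetric_H[OF Q_closure, of W "perp W"] assms
  by (simp add: sound_sq_Q norm_eq_sqrt_inner)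

text \<open>By symmetry only \<open>perp W \<bullet> Hp Q W\<close> enters, where \<open>Hp\<close>
  can be replaced by \<open>Hm\<close>. The conditions on the derivative of c from the two sides
  thus become one condition.\<close>

lemma perp_deriv_c_plus:
  assumes "W \<noteq> 0"
  shows "perp_deriv_c \<gamma> K (Omega_plus S) (phi_plus S) Q
    = - (\<gamma> - 1) / (2 * norm W) * (perp W \<bullet> Hm Q W)"
  using plus.perp_deriv_c_eq[OF Q_plus, of \<gamma> K] plus.symmetric_H[OF Q_plus, of W "perp W"] assms
  by (simp add: sound_sq_Q gp_Q phi_Q norm_eq_sqrt_inner perp_hessians_agree)

lemma perp_deriv_c_eq_0_iff:
  assumes "W \<noteq> 0"
  shows "perp_deriv_c \<gamma> K (Omega_minus S) (phi_minus S) Q = 0 \<longleftrightarrow> perp W \<bullet> Hm Q W = 0"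
    "perp_deriv_c \<gamma> K (Omega_plus S) (phi_plus S) Q = 0 \<longleftrightarrow> perp W \<bullet> Hm Q W = 0"
  using assms gamma_gt_1 by (simp_all add: perp_deriv_c_minus perp_deriv_c_plus)

lemma pseudo_velocity_minus:
  "p \<in> closure (Omega_minus S) \<Longrightarrow> pseudo_velocity S p = gm p"
  using closure_disjoint_plus minus.trace_grad[of p] by (auto simp: pseudo_velocity_def)

lemma pseudo_velocity_plus:
  "p \<in> Omega_plus S \<union> Gamma_sonic S \<Longrightarrow> pseudo_velocity S p = gp p"
  using pseudo_velocity_minus[of p] g_match[of p] Gamma_closure plus.grad_eq[of p]
  by (cases "p \<in> Omega_plus S") (auto simp: pseudo_velocity_def)

text \<open>The velocity may have a kink across the sonic curve, but its component along
  \<open>perp W\<close> has the same linearisation from both sides; the two one-sided derivatives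
  therefore glue.\<close>

lemma perp_velocity_derivative:
  assumes "W \<noteq> 0"
  shows "((\<lambda>p. perp W \<bullet> pseudo_velocity S p) has_derivative (\<lambda>v. perp W \<bullet> Hm Q v)) (at Q within flow_region)"
proof (rule has_derivative_within_Un)
  show "((\<lambda>p. perp W \<bullet> pseudo_velocity S p) has_derivative (\<lambda>v. perp W \<bullet> Hm Q v))
      (at Q within closure (Omega_minus S))"
    by (rule has_derivative_transform[OF Q_closure _ has_derivative_inner_right[OF Dgm]])
       (simp add: pseudo_velocity_minus)
  have "((\<lambda>p. perp W \<bullet> pseudo_velocity S p) has_derivative (\<lambda>v. perp W \<bullet> Hp Q v))
      (at Q within (Omega_plus S \<union> Gamma_sonic S))"
    by (rule has_derivative_transform[OF Q_plus _ has_derivative_inner_right[OF Dgp]])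
       (simp add: pseudo_velocity_plus)
  then show "((\<lambda>p. perp W \<bullet> pseudo_velocity S p) has_derivative (\<lambda>v. perp W \<bullet> Hm Q v))
      (at Q within (Omega_plus S \<union> Gamma_sonic S))"
    by (simp add: perp_hessians_agree[OF assms])
qed

lemma pseudo_velocity_continuous: "(pseudo_velocity S \<longlongrightarrow> W) (at Q within flow_region)"
proof -
  have "(pseudo_velocity S \<longlongrightarrow> W) (at Q within closure (Omega_minus S))"
    by (rule Lim_transform_within[OF has_derivative_continuous[OF Dgm, unfolded continuous_within] zero_less_one])
       (simp add: pseudo_velocity_minus)
  moreover have "(pseudo_velocity S \<longlongrightarrow> W) (at Q within (Omega_plus S \<union> Gamma_sonic S))"
    by (rule Lim_transform_within[OF _ zero_less_one])
       (use has_derivative_continuous[OF Dgp, unfolded continuous_within] in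
         \<open>auto simp: gp_Q pseudo_velocity_plus\<close>)
  ultimately show ?thesis by (simp add: Lim_within_Un)
qed

end

section \<open>The streamline through the sonic point\<close>

locale streamline_at = sonic_pair_at \<gamma> K S gm Hm gp Hp Q \<tau> e for \<gamma> K S gm Hm gp Hp Q \<tau> e +
  fixes b1 b2 x0 :: real and F :: "real \<Rightarrow> real"
  assumes F: "C2_real_on {b1<..<b2} F" and stream: "streamline_graph S {b1<..<b2} F"
    and x0: "x0 \<in> {b1<..<b2}" and Q_eq: "Q = (x0, F x0)"
    and U_neq_0: "fst (gm Q) \<noteq> 0"
begin

lemma DF: "x \<in> {b1<..<b2} \<Longrightarrow> (F has_real_derivative deriv F x) (at x)"
  and DDF: "x \<in> {b1<..<b2} \<Longrightarrow> (deriv F has_real_derivative deriv (deriv F) x) (at x)"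
  using F by (auto simp: C2_real_on_def differentiable_on_eq_differentiable_at
      DERIV_deriv_iff_real_differentiable)

lemma W_neq_0: "W \<noteq> 0"
  using U_neq_0 by auto

lemma in_flow_region: "x \<in> {b1<..<b2} \<Longrightarrow> (x, F x) \<in> flow_region"
  using stream closure_subset[of "Omega_minus S"] by (auto simp: streamline_graph_def)

lemma velocity_along:
  assumes "x \<in> {b1<..<b2}"
  shows "snd (pseudo_velocity S (x, F x)) = fst (pseudo_velocity S (x, F x)) * deriv F x"
  using stream assms by (force simp: streamline_graph_def)

lemma W_eq: "W = (fst W, fst W * deriv F x0)"
  using velocity_along[OF x0, folded Q_eq] pseudo_velocity_minus[OF Q_closure] by (simp add: prod_eq_iff)

lemma graph_derivative: "((\<lambda>x. (x, F x)) has_derivative (\<lambda>t. t *\<^sub>R (1, deriv F x0))) (at x0)"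
proof -
  have "(F has_derivative (\<lambda>t. t * deriv F x0)) (at x0)"
    using DF[OF x0] by (simp add: has_field_derivative_def mult_commute_abs)
  then show ?thesis using has_derivative_Pair[OF has_derivative_ident] by simp
qed

text \<open>The component of the velocity along \<open>perp W\<close> is differentiated along the
  streamline in two ways: the chain rule gives the Hessian term, and tangency of the velocity to the
  graph gives the second derivative of \<open>F\<close>.\<close>

lemma curvature: "deriv (deriv F) x0 * (fst W)^3 = - (perp W \<bullet> Hm Q W)"
proof -
  let ?I = "{b1<..<b2}"
  define m where "m = (\<lambda>x. pseudo_velocity S (x, F x))"
  have atI: "at x0 within ?I = at x0" using x0 by (intro at_within_open) auto
  have "((\<lambda>p. perp W \<bullet> pseudo_velocity S p) has_derivative (\<lambda>v. perp W \<bullet> Hm Q v))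
      (at (x0, F x0) within (\<lambda>x. (x, F x)) ` ?I)"
    unfolding Q_eq[symmetric] using perp_velocity_derivative[OF W_neq_0]
    by (rule has_derivative_subset) (rule image_subsetI[OF in_flow_region])
  from has_derivative_in_compose[OF has_derivative_at_withinI[OF graph_derivative] this]
  have "((\<lambda>x. perp W \<bullet> m x) has_derivative (\<lambda>t. perp W \<bullet> Hm Q (t *\<^sub>R (1, deriv F x0)))) (at x0)"
    unfolding atI m_def .
  moreover have "perp W \<bullet> Hm Q (t *\<^sub>R (1, deriv F x0)) = (perp W \<bullet> Hm Q (1, deriv F x0)) * t" for t
    using linear_scale[OF minus.linear_H[OF Q_closure]] by (simp del: scaleR_Pair)
  ultimately have D1: "((\<lambda>x. perp W \<bullet> m x) has_real_derivative perp W \<bullet> Hm Q (1, deriv F x0)) (at x0)"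
    by (simp add: has_field_derivative_def)
  \<comment> \<open>Tangency produces the factor \<open>deriv F x0 - deriv F x\<close>, which
    vanishes at \<open>x0\<close>. To differentiate the product there, continuity of the other
    factor \<open>fst (m x)\<close> suffices.\<close>
  have m: "perp W \<bullet> m x = fst W * (fst (m x) * (deriv F x0 - deriv F x))" if "x \<in> ?I" for x
    using velocity_along[OF that] W_eq
    by (cases W) (simp add: m_def perp_def inner_prod_def algebra_simps)
  have "((\<lambda>x. m x) \<longlongrightarrow> W) (at x0)"
  proof -
    have "((\<lambda>x. (x, F x)) \<longlongrightarrow> Q) (at x0)"
      using has_derivative_continuous[OF graph_derivative] by (simp add: continuous_within Q_eq)
    moreover have "\<forall>\<^sub>F x in at x0. x \<in> ?I"
      using x0 by (intro eventually_at_in_open') auto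
    then have "\<forall>\<^sub>F x in at x0. (x, F x) \<in> flow_region \<and> (x, F x) \<noteq> Q"
      using eventually_neq_at_within[of x0 x0 UNIV]
      by eventually_elim (simp add: in_flow_region[simplified] Q_eq)
    ultimately have "filterlim (\<lambda>x. (x, F x)) (at Q within flow_region) (at x0)"
      unfolding filterlim_at by blast
    from filterlim_compose[OF pseudo_velocity_continuous this] show ?thesis by (simp add: m_def)
  qed
  then have "((\<lambda>x. fst W * (fst (m x) * - ((deriv F x - deriv F x0) / (x - x0)))) \<longlongrightarrow>
      fst W * (fst W * - deriv (deriv F) x0)) (at x0)"
    by (intro tendsto_intros DDF[OF x0, unfolded has_field_derivative_iff])
  moreover have "\<forall>\<^sub>F x in at x0. fst W * (fst (m x) * - ((deriv F x - deriv F x0) / (x - x0)))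
      = (perp W \<bullet> m x - perp W \<bullet> m x0) / (x - x0)"
  proof -
    have "\<forall>\<^sub>F x in at x0. x \<in> ?I" using x0 by (intro eventually_at_in_open') auto
    then show ?thesis
    proof eventually_elim
      case (elim x)
      show ?case unfolding m[OF elim] m[OF x0] by (simp add: algebra_simps diff_divide_distrib)
    qed
  qed
  ultimately have "((\<lambda>x. perp W \<bullet> m x) has_real_derivative fst W * (fst W * - deriv (deriv F) x0)) (at x0)"
    unfolding has_field_derivative_iff by (rule Lim_transform_eventually)
  with D1 have eq: "perp W \<bullet> Hm Q (1, deriv F x0) = fst W * (fst W * - deriv (deriv F) x0)"
    by (rule DERIV_unique)
  \<comment> \<open>Rescaling the graph direction to \<open>W\<close> brings the third factor of the
    horizontal velocity.\<close>
  have "W = fst W *\<^sub>R (1, deriv F x0)" using W_eq by simp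
  then have "Hm Q W = fst W *\<^sub>R Hm Q (1, deriv F x0)"
    using linear_scale[OF minus.linear_H[OF Q_closure]] by metis
  then have "perp W \<bullet> Hm Q W = fst W * (perp W \<bullet> Hm Q (1, deriv F x0))" by simp
  then show ?thesis unfolding eq by (simp add: power3_eq_cube)
qed

lemma curvature_eq_0_iff: "deriv (deriv F) x0 = 0 \<longleftrightarrow> perp W \<bullet> Hm Q W = 0"
  using curvature U_neq_0 by auto

text \<open>The sign comes from the growth of \<open>excess\<close> into the supersonic region, once
  its gradient is known to be normal to the streamline.\<close>

lemma curvature_nonneg:
  assumes above: "\<And>x y. \<lbrakk>x \<in> {b1<..<b2}; (x, y) \<in> Omega_minus S\<rbrakk> \<Longrightarrow> y > F x"
  shows "deriv (deriv F) x0 \<ge> 0"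
proof -
  let ?I = "{b1<..<b2}" and ?s = "deriv F x0"
  \<comment> \<open>A defining function of the streamline: zero at \<open>Q\<close> and, by
    continuity, nonnegative on the closed supersonic region over the interval.\<close>
  define \<Phi> where "\<Phi> = (\<lambda>p. snd p - F (fst p))"
  have "(F has_derivative (*) ?s) (at (fst Q))"
    using DF[OF x0] by (simp add: Q_eq has_field_derivative_def)
  from has_derivative_compose[OF has_derivative_fst[OF has_derivative_ident] this]
  have D\<Phi>: "(\<Phi> has_derivative (\<lambda>v. snd v - ?s * fst v)) (at Q)"
    unfolding \<Phi>_def by (intro has_derivative_diff has_derivative_snd has_derivative_ident)
  have \<Phi>Q: "\<Phi> Q = 0" by (simp add: \<Phi>_def Q_eq)
  have strip: "open {p :: real \<times> real. fst p \<in> ?I}"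
    using open_vimage_fst[of ?I] by (simp add: vimage_def)
  have \<Phi>_closure: "\<Phi> p \<ge> 0" if p: "p \<in> closure (Omega_minus S)" "fst p \<in> ?I" for p
  proof (rule ccontr)
    assume "\<not> \<Phi> p \<ge> 0"
    have cF: "continuous_on ?I F"
      using DF by (meson DERIV_isCont continuous_at_imp_continuous_on)
    have "continuous_on {p. fst p \<in> ?I} \<Phi>"
      unfolding \<Phi>_def by (intro continuous_intros continuous_on_compose2[OF cF]) auto
    then have "open ({p. fst p \<in> ?I} \<inter> \<Phi> -` {..<0})"
      using strip by (metis continuous_on_open_vimage open_lessThan Int_commute)
    moreover have "p \<in> {p. fst p \<in> ?I} \<inter> \<Phi> -` {..<0}" using p \<open>\<not> \<Phi> p \<ge> 0\<close> by auto
    ultimately have "({p. fst p \<in> ?I} \<inter> \<Phi> -` {..<0}) \<inter> Omega_minus S \<noteq> {}"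
      using p(1) by (meson disjoint_iff open_Int_closure_eq_empty IntI)
    then show False using above by (force simp: \<Phi>_def)
  qed
  obtain \<psi> where \<psi>: "\<psi> 0 = Q" "(\<psi> has_derivative (\<lambda>t. t *\<^sub>R \<tau>)) (at (0::real))"
      "\<forall>\<^sub>F t in at 0. \<psi> t \<in> Gamma_sonic S"
    and ray: "\<forall>\<^sub>F t in at_right 0. Q + t *\<^sub>R e \<in> Omega_minus S"
    and indep: "\<And>v. v \<bullet> \<tau> = 0 \<Longrightarrow> v \<bullet> e = 0 \<Longrightarrow> v = 0"
    using tangent by (auto simp: sonic_tangent_def)
  \<comment> \<open>Along the path in the sonic curve \<open>\<Phi>\<close> has a local minimum at
    \<open>Q\<close>, so the curve is tangent to the streamline there.\<close>
  have tan: "snd \<tau> = ?s * fst \<tau>"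
  proof -
    have "((\<lambda>t. \<Phi> (\<psi> t)) has_derivative (\<lambda>t. snd (t *\<^sub>R \<tau>) - ?s * fst (t *\<^sub>R \<tau>))) (at 0)"
      using has_derivative_compose[OF \<psi>(2), of \<Phi>] D\<Phi> \<psi>(1) by blast
    then have D: "((\<lambda>t. \<Phi> (\<psi> t)) has_real_derivative snd \<tau> - ?s * fst \<tau>) (at 0)"
      unfolding has_field_derivative_def by (rule has_derivative_eq_rhs) (simp add: fun_eq_iff algebra_simps)
    have "(\<psi> \<longlongrightarrow> Q) (at 0)"
      using has_derivative_continuous[OF \<psi>(2)] by (simp add: continuous_within \<psi>(1))
    then have "\<forall>\<^sub>F t in at 0. \<psi> t \<in> {p. fst p \<in> ?I}"
      by (rule topological_tendstoD[OF _ strip]) (use x0 Q_eq in simp)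
    with \<psi>(3) have "\<forall>\<^sub>F t in at 0. \<Phi> (\<psi> 0) \<le> \<Phi> (\<psi> t)"
    proof eventually_elim
      case (elim t)
      then show ?case using \<Phi>_closure[of "\<psi> t"] Gamma_closure by (auto simp: \<psi>(1) \<Phi>Q)
    qed
    then obtain d where "d > 0" "\<And>t. t \<noteq> 0 \<Longrightarrow> dist t 0 < d \<Longrightarrow> \<Phi> (\<psi> 0) \<le> \<Phi> (\<psi> t)"
      by (auto simp: eventually_at)
    then have "\<forall>t. \<bar>0 - t\<bar> < d \<longrightarrow> \<Phi> (\<psi> 0) \<le> \<Phi> (\<psi> t)" by (auto simp: dist_real_def) (metis order_refl)
    from DERIV_local_min[OF D \<open>d > 0\<close> this] show ?thesis by simp
  qed
  \<comment> \<open>The ray stays above the streamline, which gives the weak inequality. Equality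
    would make the nonzero vector \<open>(- ?s, 1)\<close> orthogonal to both \<open>\<tau>\<close>
    and \<open>e\<close>.\<close>
  have e_up: "snd e - ?s * fst e > 0"
  proof -
    have "((\<lambda>t. Q + t *\<^sub>R e) \<longlongrightarrow> Q + 0 *\<^sub>R e) (at_right 0)" by (intro tendsto_intros)
    then have "\<forall>\<^sub>F t in at_right 0. Q + t *\<^sub>R e \<in> {p. fst p \<in> ?I}"
      by (intro topological_tendstoD[OF _ strip]) (use x0 Q_eq in auto)
    with ray have "\<forall>\<^sub>F t in at_right 0. Q + t *\<^sub>R e \<in> UNIV \<and> \<Phi> (Q + t *\<^sub>R e) \<ge> \<Phi> Q"
    proof eventually_elim
      case (elim t)
      then show ?case
        using \<Phi>_closure[of "Q + t *\<^sub>R e"] closure_subset[of "Omega_minus S"] by (auto simp: \<Phi>Q)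
    qed
    then have "snd e - ?s * fst e \<ge> 0"
      by (rule one_sided_directional_derivative_nonneg[OF D\<Phi>])
    moreover have "snd e - ?s * fst e \<noteq> 0"
      using indep[of "(- ?s, 1)"] tan by (auto simp: inner_prod_def zero_prod_def)
    ultimately show ?thesis by simp
  qed
  \<comment> \<open>\<open>excess\<close> is zero at \<open>Q\<close> and positive along the
    ray.\<close>
  have excess_e: "(\<gamma> + 1) * (W \<bullet> Hm Q e) + (\<gamma> - 1) * (W \<bullet> e) \<ge> 0"
  proof (rule one_sided_directional_derivative_nonneg[OF has_derivative_excess[OF Dphi_minus Dgm]])
    show "\<forall>\<^sub>F t in at_right 0. Q + t *\<^sub>R e \<in> closure (Omega_minus S) \<and>
        excess \<gamma> K (phi_minus S (Q + t *\<^sub>R e)) (gm (Q + t *\<^sub>R e)) \<ge> excess \<gamma> K (phi_minus S Q) (gm Q)"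
      using ray
    proof eventually_elim
      case (elim t)
      then show ?case
        using excess_minus[of "Q + t *\<^sub>R e"] closure_subset[of "Omega_minus S"]
        by (auto simp: excess_Gamma[OF Q_Gamma])
    qed
  qed
  obtain a b c where H: "\<And>v. Hm Q v = (a * fst v + b * snd v, b * fst v + c * snd v)"
    using minus.symmetric_entries[OF Q_closure] by metis
  define U where "U = fst W"
  have WU: "W = (U, U * ?s)" using W_eq by (simp add: U_def)
  have U: "U \<noteq> 0" using U_neq_0 by (simp add: U_def)
  \<comment> \<open>\<open>(p, q)\<close> is the gradient of \<open>excess\<close> at
    \<open>Q\<close> from the supersonic side.\<close>
  define p q where "p = (\<gamma> + 1) * (U * a + U * ?s * b) + (\<gamma> - 1) * U"
    and "q = (\<gamma> + 1) * (U * b + U * ?s * c) + (\<gamma> - 1) * (U * ?s)"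
  have DE: "(\<gamma> + 1) * (W \<bullet> Hm Q v) + (\<gamma> - 1) * (W \<bullet> v) = p * fst v + q * snd v" for v
    unfolding WU H p_def q_def by (simp add: inner_prod_def algebra_simps)
  have "fst \<tau> \<noteq> 0" using tau_neq_0 tan by (auto simp: prod_eq_iff)
  moreover have "(p + q * ?s) * fst \<tau> = 0"
    using excess_tangential tan unfolding DE by (simp add: algebra_simps)
  \<comment> \<open>The gradient annihilates the tangent \<open>(1, ?s)\<close>, so it is
    \<open>q\<close> times the upward normal \<open>(- ?s, 1)\<close>; the ray then gives the sign
    of \<open>q\<close>.\<close>
  ultimately have p: "p = - q * ?s" by simp
  have "q * (snd e - ?s * fst e) \<ge> 0" using excess_e unfolding DE p by (simp add: algebra_simps)
  then have "q \<ge> 0" using e_up by (simp add: zero_le_mult_iff)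
  have curv: "deriv (deriv F) x0 * U^3 = - (U * ?s * (a * U + b * (U * ?s)) - U * (b * U + c * (U * ?s)))"
    using curvature unfolding WU H by (simp add: perp_def inner_prod_def algebra_simps)
  \<comment> \<open>\<open>q - ?s * p\<close> is the derivative of \<open>excess\<close> along
    \<open>(- ?s, 1)\<close>. This vector is orthogonal to \<open>W\<close>, so the terms with
    \<open>\<gamma> - 1\<close> cancel and the remaining Hessian term is the curvature.\<close>
  have "(\<gamma> + 1) * (deriv (deriv F) x0 * U^3) = U * (q - ?s * p)"
    unfolding curv p_def q_def by (simp add: algebra_simps)
  also have "\<dots> = U * (q * (1 + ?s\<^sup>2))" unfolding p by (simp add: algebra_simps power2_eq_square)
  finally have "U * (((\<gamma> + 1) * U\<^sup>2) * deriv (deriv F) x0) = U * (q * (1 + ?s\<^sup>2))"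
    by (simp add: power2_eq_square power3_eq_cube algebra_simps)
  then have "((\<gamma> + 1) * U\<^sup>2) * deriv (deriv F) x0 = q * (1 + ?s\<^sup>2)"
    using U by (metis mult_left_cancel)
  moreover have "q * (1 + ?s\<^sup>2) \<ge> 0" using \<open>q \<ge> 0\<close> by (intro mult_nonneg_nonneg) auto
  moreover have "(\<gamma> + 1) * U\<^sup>2 > 0" using gamma_gt_1 U by simp
  ultimately show ?thesis by (metis zero_le_mult_iff not_less)
qed

end

text \<open>The angle \<open>\<theta>\<close> expresses the free choice of local coordinates. Each
  part accepts its hypothesis on the derivative of c from either side, which is the strongest
  reading.\<close>

theorem theorem2p4:
  fixes \<gamma> K \<theta> b1 b2 \<xi>Q :: real
    and S T :: sonic_flow
    and Q :: "real \<times> real"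
    and F :: "real \<Rightarrow> real"
  assumes "\<gamma> > 1"
    and "sonic_configuration \<gamma> K S"
    and "T = rotate_coords \<theta> S"
    and "Q \<in> Gamma_sonic T"
    and "fst (pseudo_velocity T Q) \<noteq> 0"
    and "b1 < b2"
    and "C2_real_on {b1<..<b2} F"
    and "streamline_graph T {b1<..<b2} F"
    and "\<xi>Q \<in> {b1<..<b2}"
    and "Q = (\<xi>Q, F \<xi>Q)"
  shows "(perp_deriv_c \<gamma> K (Omega_minus T) (phi_minus T) Q = 0 \<or>
          perp_deriv_c \<gamma> K (Omega_plus T) (phi_plus T) Q = 0
            \<longrightarrow> deriv (deriv F) \<xi>Q = 0) \<and>
         ((perp_deriv_c \<gamma> K (Omega_minus T) (phi_minus T) Q \<noteq> 0 \<or>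
           perp_deriv_c \<gamma> K (Omega_plus T) (phi_plus T) Q \<noteq> 0) \<and>
          (\<exists>G :: real \<Rightarrow> real. (\<forall>\<xi>\<in>{b1<..<b2}. G \<xi> = F \<xi>) \<and>
             Omega_minus T \<subseteq> {(\<xi>, \<eta>). \<eta> > G \<xi>})
            \<longrightarrow> deriv (deriv F) \<xi>Q > 0)"
proof -
  obtain gm Hm gp Hp \<tau> e where "sonic_pair_at \<gamma> K T gm Hm gp Hp Q \<tau> e"
    using sonic_configuration_imp_sonic_pair_at[OF assms(1,2)] assms(3,4) by metis
  then interpret sonic_pair_at \<gamma> K T gm Hm gp Hp Q \<tau> e .
  interpret streamline_at \<gamma> K T gm Hm gp Hp Q \<tau> e b1 b2 \<xi>Q F
    by unfold_locales (use assms pseudo_velocity_minus[OF Q_closure] in auto)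
  \<comment> \<open>Over the interval \<open>G\<close> coincides with \<open>F\<close>, so the
    supersonic region lies above the streamline there. Strictness follows since the second
    derivative vanishes only together with the derivative of c.\<close>
  have "deriv (deriv F) \<xi>Q \<ge> 0"
    if "\<forall>\<xi>\<in>{b1<..<b2}. G \<xi> = F \<xi>" "Omega_minus T \<subseteq> {(\<xi>, \<eta>). \<eta> > G \<xi>}" for G
    using that by (intro curvature_nonneg) force
  then show ?thesis
    unfolding perp_deriv_c_eq_0_iff[OF W_neq_0] curvature_eq_0_iff[symmetric]
    by (auto simp: order.order_iff_strict)
qed

end
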